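(* We have \begin{equation*} \sum_{n\ge d\ge 1} A_1(2n,d) v^d u^n =\frac{v\sin(\pi \sqrt{(1-v)u})}{ \sqrt{1-v}\, \sin(\pi \sqrt{u})} \left(\frac{1}{2(1-v)}- \frac{\pi\sqrt{u}}{2\sqrt{1-v}\, \sin( \pi\sqrt{(1-v)u})} \right) \end{equation*} and \begin{equation*} 1+\sum_{n\ge d\ge 1} A_d(2n,d) v^d u^n = \frac{\sin( \pi \sqrt{(1-v)u}/2) }{ \sqrt{1-v}\,\sin(\pi\sqrt u/2)} \cdot\frac{\cos(\pi \sqrt{(v+1)u}/2)}{ \cos(\pi\sqrt u/2)} . \end{equation*}
   Context: For positive integers $s_1,\dots,s_d$ and signs $\varepsilon_1,\dots,\varepsilon_d\in\{1,-1\}$ with $(s_1,\varepsilon_1)\ne(1,1)$, the (alternating) Euler sum is $$\zeta(s_1,\dots,s_d;\varepsilon_1,\dots,\varepsilon_d)=\sum_{n_1>\cdots>n_d\ge 1}\frac{\varepsilon_1^{n_1}\cdots \varepsilon_d^{n_d}}{ n_1^{s_1}\cdots n_d^{s_d}}.$$ For integers $0\le\alpha\le d\le n$, $$A_\alpha(2n,d)=\sum \zeta(2j_1,\dots,2j_d;\varepsilon_1,\dots,\varepsilon_d),$$ where the sum is over all positive integers $j_1,\dots,j_d$ with $j_1+\cdots+j_d=n$ and all $(\varepsilon_1,\dots,\varepsilon_d)\in\{1,-1\}^d$ with exactly $\alpha$ of the $\varepsilon_\ell$ equal to $-1$. The generating series run over all pairs of integers $(n,d)$ with $n\ge d\ge1$.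 The identities are of power series in $u$ and $v$; in the right-hand sides the square roots cancel, so that they expand as power series in $u,v$. *)

theory Defs
  imports Complex_Main "HOL-Computational_Algebra.Computational_Algebra"
begin

section \<open>Euler sums\<close>

text \<open>The sum over \<open>n\<^sub>1 > \<dots> > n\<^sub>d \<ge> 1\<close> is the limit of its truncations \<open>n\<^sub>1 \<le> N\<close>; this is needed
  since it converges only conditionally when \<open>(s\<^sub>1, \<epsilon>\<^sub>1) = (1, -1)\<close>.\<close>

definition euler_sum :: "nat list \<Rightarrow> int list \<Rightarrow> real" where
  "euler_sum s e = lim (\<lambda>N.
     \<Sum>n | length n = length s \<and> set n \<subseteq> {1..N} \<and> sorted_wrt (>) n.
       \<Prod>i<length s. of_int (e ! i) ^ (n ! i) / real (n ! i) ^ (s ! i))"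

definition A_index :: "nat \<Rightarrow> nat \<Rightarrow> nat \<Rightarrow> (nat list \<times> int list) set" where
  "A_index \<alpha> w d = {(j, e). length j = d \<and> (\<forall>x\<in>set j. x > 0) \<and> 2 * sum_list j = w \<and>
     length e = d \<and> set e \<subseteq> {1, -1} \<and> count_list e (-1) = \<alpha>}"

definition A :: "nat \<Rightarrow> nat \<Rightarrow> nat \<Rightarrow> real" where
  "A \<alpha> w d = (\<Sum>(j, e)\<in>A_index \<alpha> w d. euler_sum (map (\<lambda>x. 2 * x) j) e)"

lemma finite_A_index: "finite (A_index \<alpha> w d)"
proof (rule finite_subset)
  show "A_index \<alpha> w d \<subseteq>
      {j. set j \<subseteq> {..w} \<and> length j = d} \<times> {e. set e \<subseteq> {1, -1} \<and> length e = d}"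
  proof
    fix p assume "p \<in> A_index \<alpha> w d"
    then obtain j e where p: "p = (j, e)" and *: "(j, e) \<in> A_index \<alpha> w d"
      by (cases p) auto
    have "x \<le> w" if "x \<in> set j" for x
      using member_le_sum_list[OF that] * by (auto simp: A_index_def)
    then show "p \<in> {j. set j \<subseteq> {..w} \<and> length j = d} \<times> {e. set e \<subseteq> {1, -1} \<and> length e = d}"
      using * p by (auto simp: A_index_def)
  qed
  show "finite ({j :: nat list. set j \<subseteq> {..w} \<and> length j = d} \<times>
      {e :: int list. set e \<subseteq> {1, -1} \<and> length e = d})"
    by (intro finite_cartesian_product finite_lists_length_eq) simp_all
qed

section \<open>Power series in two variables and their square roots\<close>

text \<open>A power series in \<open>u, v\<close> has type \<^typ>\<open>real fps fps\<close>: the outer variable is \<open>u\<close> and the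
  inner one is \<open>v\<close>. The sum \<open>\<Sum> a n d v\<^sup>d u\<^sup>n\<close> below is over \<open>n \<ge> d \<ge> 1\<close>.\<close>

definition gen_series :: "(nat \<Rightarrow> nat \<Rightarrow> real) \<Rightarrow> real fps fps" where
  "gen_series a = Abs_fps (\<lambda>n. Abs_fps (\<lambda>d. if 1 \<le> d \<and> d \<le> n then a n d else 0))"

text \<open>Closed formulas involving \<open>\<surd>u\<close> live in the ring \<open>\<real>((v))[[\<surd>u]]\<close>, of type
  \<^typ>\<open>real fls fps\<close>. Its variable \<^const>\<open>fps_X\<close> is \<open>\<surd>u\<close>, and power series in \<open>u, v\<close> are embedded
  by \<open>u = (\<surd>u)\<^sup>2\<close>. Coefficients are Laurent series in \<open>v\<close> only in order to have a field, as
  \<^const>\<open>fps_sin\<close>, \<^const>\<open>fps_cos\<close> and exact division require. The roots of \<open>1 - v\<close> and \<open>1 + v\<close>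
  are the power series in \<open>v\<close> with constant term 1.\<close>

definition embed_series :: "real fps fps \<Rightarrow> real fls fps" where
  "embed_series F = Abs_fps (\<lambda>n. fps_to_fls (fps_nth F n)) oo fps_X ^ 2"

definition sqrt_u :: "real fls fps" where
  "sqrt_u = fps_X"

definition V :: "real fls fps" where
  "V = fps_const (fps_to_fls fps_X)"

definition sqrt_1_minus_v :: "real fls fps" where
  "sqrt_1_minus_v = fps_const (fps_to_fls (fps_radical root 2 (1 - fps_X)))"

definition sqrt_1_plus_v :: "real fls fps" where
  "sqrt_1_plus_v = fps_const (fps_to_fls (fps_radical root 2 (1 + fps_X)))"

definition PI :: "real fls fps" where
  "PI = fps_const (fls_const pi)"

text \<open>The formal \<open>sin t\<close> and \<open>cos t\<close>, meaningful when \<open>t\<close> has no constant term in \<open>\<surd>u\<close>.\<close>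

definition Sin :: "real fls fps \<Rightarrow> real fls fps" where
  "Sin t = fps_sin 1 oo t"

definition Cos :: "real fls fps \<Rightarrow> real fls fps" where
  "Cos t = fps_cos 1 oo t"

lemma sqrt_1_minus_v_square: "sqrt_1_minus_v ^ 2 = 1 - V"
proof -
  have "fps_radical root 2 (1 - fps_X :: real fps) ^ 2 = 1 - fps_X"
    using power_radical[of "1 - fps_X :: real fps" root 1] by (simp add: numeral_2_eq_2)
  then have "sqrt_1_minus_v ^ 2 = fps_const (fps_to_fls (1 - fps_X))"
    by (simp add: sqrt_1_minus_v_def flip: fps_to_fls_power)
  also have "\<dots> = 1 - V"
    by (simp add: V_def fps_to_fls_minus flip: fps_const_sub)
  finally show ?thesis .
qed

lemma sqrt_1_plus_v_square: "sqrt_1_plus_v ^ 2 = 1 + V"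
proof -
  have "fps_radical root 2 (1 + fps_X :: real fps) ^ 2 = 1 + fps_X"
    using power_radical[of "1 + fps_X :: real fps" root 1] by (simp add: numeral_2_eq_2)
  then have "sqrt_1_plus_v ^ 2 = fps_const (fps_to_fls (1 + fps_X))"
    by (simp add: sqrt_1_plus_v_def flip: fps_to_fls_power)
  also have "\<dots> = 1 + V"
    by (simp add: V_def fps_to_fls_plus flip: fps_const_add)
  finally show ?thesis .
qed

lemma embed_series_nth:
  "fps_nth (embed_series F) k = (if even k then fps_to_fls (fps_nth F (k div 2)) else 0)"
proof -
  have "fps_nth (embed_series F) k
      = (\<Sum>i=0..k. if k = 2 * i then fps_to_fls (fps_nth F i) else 0)"
    by (auto simp: embed_series_def fps_compose_nth simp flip: power_mult intro!: sum.cong)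
  also have "\<dots> = (if even k then fps_to_fls (fps_nth F (k div 2)) else 0)"
  proof (cases "even k")
    case True
    then have "(\<Sum>i=0..k. if k = 2 * i then fps_to_fls (fps_nth F i) else 0)
        = (\<Sum>i=0..k. if i = k div 2 then fps_to_fls (fps_nth F i) else 0)"
      by (intro sum.cong) auto
    then show ?thesis using True by simp
  qed (auto intro!: sum.neutral)
  finally show ?thesis .
qed

lemma inj_embed_series: "inj embed_series"
proof (rule injI, rule fps_ext)
  fix F G :: "real fps fps" and n
  assume "embed_series F = embed_series G"
  then have "fps_nth (embed_series F) (2 * n) = fps_nth (embed_series G) (2 * n)" by simp
  then show "fps_nth F n = fps_nth G n" by (simp add: embed_series_nth)
qed

text \<open>Every quotient \<open>f / g\<close> formed with the following numerators and denominators is exact, that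
  is, \<open>g\<close> divides \<open>f\<close>: in a ring of power series over a field this only depends on the order of
  vanishing in \<open>\<surd>u\<close>.\<close>

lemma sqrt_1_minus_v_eq_const:
  obtains c where "sqrt_1_minus_v = fps_const c" "c \<noteq> 0"
proof -
  have "fps_radical root 2 (1 - fps_X :: real fps) \<noteq> 0"
    by (auto simp: fps_eq_iff intro!: exI[of _ 0])
  then show thesis
    using that by (simp add: sqrt_1_minus_v_def)
qed

lemma Sin_const_mult_X: "Sin (fps_const c * fps_X) = fps_sin c"
  by (simp add: Sin_def fps_compose_linear fps_sin_def fps_eq_iff)

lemma Cos_const_mult_X: "Cos (fps_const c * fps_X) = fps_cos c"
  by (simp add: Cos_def fps_compose_linear fps_cos_def fps_eq_iff)

lemma subdegree_fps_sin: "c \<noteq> 0 \<Longrightarrow> subdegree (fps_sin c) = 1"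
  by (rule subdegreeI) auto

lemma exact_quotients:
  "sqrt_1_minus_v * Sin (PI * sqrt_u) dvd V * Sin (PI * sqrt_1_minus_v * sqrt_u)"
  "2 * (1 - V) dvd 1"
  "2 * sqrt_1_minus_v * Sin (PI * sqrt_1_minus_v * sqrt_u) dvd PI * sqrt_u"
  "sqrt_1_minus_v * Sin (PI * sqrt_u / 2) dvd Sin (PI * sqrt_1_minus_v * sqrt_u / 2)"
  "Cos (PI * sqrt_u / 2) dvd Cos (PI * sqrt_1_plus_v * sqrt_u / 2)"
proof -
  obtain c where c: "sqrt_1_minus_v = fps_const c" "c \<noteq> 0"
    by (rule sqrt_1_minus_v_eq_const)
  have unit: "fps_const a dvd (1 :: real fls fps)" if "a \<noteq> 0" for a
    using that by (simp add: fps_is_unit_iff)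
  have two: "(2 :: real fls fps) = fps_const 2"
    by (simp add: numeral_fps_const)
  have half: "x / 2 = x * fps_const (1 / 2)" for x :: "real fls fps"
  proof -
    have "x * fps_const (1 / 2) * 2 = x * fps_const (1 / 2 * 2)"
      by (simp only: two fps_const_mult mult.assoc)
    then have "x * fps_const (1 / 2) * 2 = x" by simp
    then show ?thesis
      by (metis nonzero_mult_div_cancel_right zero_neq_numeral)
  qed
  have pi: "fls_const pi \<noteq> 0" by (simp add: fls_const_nonzero)
  have s1: "PI * sqrt_u = fps_const (fls_const pi) * fps_X"
    by (simp add: PI_def sqrt_u_def)
  have s2: "PI * sqrt_1_minus_v * sqrt_u = fps_const (fls_const pi * c) * fps_X"
    by (simp add: PI_def sqrt_u_def c)
  have s3: "PI * sqrt_u / 2 = fps_const (fls_const pi / 2) * fps_X"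
    unfolding half s1 by (simp add: mult.commute mult.left_commute)
  have s4: "PI * sqrt_1_minus_v * sqrt_u / 2 = fps_const (fls_const pi * c / 2) * fps_X"
    unfolding half s2 by (simp add: mult.commute mult.left_commute)
  have dvd: "fps_const a * fps_sin b dvd f"
    if "a \<noteq> 0" "b \<noteq> 0" "fps_nth f 0 = 0" for a b :: "real fls" and f
  proof (cases "f = 0")
    case False
    have "subdegree (fps_const a * fps_sin b) \<le> subdegree f"
    proof -
      have "subdegree f \<noteq> 0" using that False by (metis nth_subdegree_nonzero)
      moreover have "fps_sin b \<noteq> 0"
        using subdegree_fps_sin[OF that(2)] by auto
      ultimately show ?thesis
        using that subdegree_fps_sin[of b] by (simp add: subdegree_mult)
    qed
    moreover have "fps_const a * fps_sin b \<noteq> 0"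
      using that subdegree_fps_sin[OF that(2)] by auto
    ultimately show ?thesis using False by (simp add: fps_dvd_iff)
  qed simp
  show "sqrt_1_minus_v * Sin (PI * sqrt_u) dvd V * Sin (PI * sqrt_1_minus_v * sqrt_u)"
    unfolding s1 s2 Sin_const_mult_X unfolding c by (rule dvd) (use c pi in simp_all)
  show "2 * (1 - V) dvd 1"
  proof -
    have "(1 - fps_X :: real fps) \<noteq> 0"
      by (auto simp: fps_eq_iff intro!: exI[of _ 0])
    moreover have "2 * (1 - V) = fps_const (2 * fps_to_fls (1 - fps_X))"
      by (simp add: V_def flip: fps_const_sub fps_const_mult numeral_fps_const)
    ultimately show ?thesis by (metis unit fps_to_fls_eq_0_iff mult_eq_0_iff zero_neq_numeral)
  qed
  have "fps_const (2 * c) * fps_sin (fls_const pi * c) dvd PI * sqrt_u"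
    by (rule dvd) (use c pi in \<open>simp_all add: s1\<close>)
  then show "2 * sqrt_1_minus_v * Sin (PI * sqrt_1_minus_v * sqrt_u) dvd PI * sqrt_u"
    unfolding s2 Sin_const_mult_X unfolding c(1) two fps_const_mult .
  show "sqrt_1_minus_v * Sin (PI * sqrt_u / 2) dvd Sin (PI * sqrt_1_minus_v * sqrt_u / 2)"
    unfolding s3 s4 Sin_const_mult_X unfolding c by (rule dvd) (use c pi in simp_all)
  have "Cos (PI * sqrt_u / 2) dvd 1"
    unfolding s3 Cos_const_mult_X by (simp add: fps_is_unit_iff)
  then show "Cos (PI * sqrt_u / 2) dvd Cos (PI * sqrt_1_plus_v * sqrt_u / 2)"
    by (rule dvd_trans) simp
qed

end

theory Submission
  imports Defs "HOL-Analysis.Analysis" "HOL-Complex_Analysis.Cauchy_Integral_Formula"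
begin

text \<open>
  Choosing \<open>n\<^sub>1 > \<dots> > n\<^sub>d\<close>, and for each of them an exponent \<open>j\<close> and a sign \<open>\<epsilon>\<close>, amounts to expanding
  a product over all \<open>n \<ge> 1\<close>: with \<open>y\<close> marking the signs \<open>-1\<close>, the generating series of all
  \<open>A\<^sub>\<alpha>(2n, d)\<close> is \<open>\<Prod>n (1 + v (1 + (-1)\<^sup>n y) g\<^sub>n)\<close>, where
  \<open>g\<^sub>n = \<Sum>j\<ge>1. u\<^sup>j / n\<^bsup>2j\<^esup> = (u / n\<^sup>2) / (1 - u / n\<^sup>2)\<close>.
  Put \<open>P(x) = \<Prod>n (1 - x / n\<^sup>2) = sin (\<pi> \<surd>x) / (\<pi> \<surd>x)\<close>.

  \<^item> The terms with \<open>v\<^sup>d y\<^sup>d\<close>, where all signs are \<open>-1\<close>, come from the product of the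
    \<open>1 + (-1)\<^sup>n v g\<^sub>n\<close>. This is \<open>(1 - (1-v) u/n\<^sup>2) / (1 - u/n\<^sup>2)\<close> for even \<open>n\<close> and
    \<open>(1 - (1+v) u/n\<^sup>2) / (1 - u/n\<^sup>2)\<close> for odd \<open>n\<close>. The product over odd \<open>n\<close> is the product over all
    \<open>n\<close> divided by the product over even \<open>n\<close>, so the series is
    \<open>P((1-v)u/4) P((1+v)u) / (P((1+v)u/4) P(u))\<close>, and duplication of the sine gives the cosines.

  \<^item> The coefficient of \<open>y\<close> is \<open>P((1-v)u) / P(u)\<close> times \<open>v \<Sum>n (-1)\<^sup>n (u/n\<^sup>2) / (1 - (1-v)u/n\<^sup>2)\<close>.
    Twice the even terms minus all terms expresses this alternating sum by the logarithmic
    derivatives of \<open>P(x/4)\<close> and \<open>P(x)\<close> at \<open>x = (1-v)u\<close>, that is, by cotangents, and these combine to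
    the reciprocal of a sine.

  To make this an argument about formal series, truncate at \<open>n\<^sub>1 \<le> N\<close>. All products become finite,
  and after denominators are cleared the two computations are identities in a commutative ring
  (\<open>one_sign_products\<close>, \<open>alternating_parity_split\<close>, \<open>all_signs_products\<close>). Then \<open>N \<rightarrow> \<infinity>\<close> coefficient
  by coefficient, an operation compatible with products. The only analytic inputs are the
  convergence of the truncated Euler sums (\<open>convergent_truncated_sum\<close>) and that of the coefficients
  of \<open>P\<close> (\<open>basel_product_tendsto\<close>), which rests on Euler's product for the sine.
\<close>

unbundle no vec_syntax

section \<open>Coefficients of the sine product\<close>

definition basel_product :: "nat \<Rightarrow> real fps" where
  "basel_product N = (\<Prod>n=1..N. 1 - fps_const (1 / real n ^ 2) * fps_X)"

lemma basel_product_0: "basel_product 0 = 1"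
  by (simp add: basel_product_def)

lemma basel_product_Suc_nth:
  "basel_product (Suc N) $ k = basel_product N $ k -
     (if k = 0 then 0 else basel_product N $ (k - 1) / real (Suc N) ^ 2)"
proof -
  have *: "basel_product (Suc N) =
      basel_product N - fps_const (1 / real (Suc N) ^ 2) * (fps_X * basel_product N)"
    by (simp add: basel_product_def algebra_simps)
  show ?thesis
    unfolding * by (simp del: of_nat_Suc)
qed

lemma basel_product_nth_eq_0: "N < k \<Longrightarrow> basel_product N $ k = 0"
proof (induction N arbitrary: k)
  case (Suc N)
  then show ?case by (simp add: basel_product_Suc_nth)
qed (simp add: basel_product_0)

lemma basel_product_eval:
  "(\<Prod>n=1..N. 1 - x / real n ^ 2) = (\<Sum>k\<le>N. basel_product N $ k * x ^ k)"
proof (induction N)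
  case (Suc N)
  let ?s = "\<lambda>k. basel_product N $ k" and ?c = "1 / real (Suc N) ^ 2"
  have "(\<Sum>k\<le>Suc N. basel_product (Suc N) $ k * x ^ k)
      = (\<Sum>k\<le>Suc N. ?s k * x ^ k) - (\<Sum>k\<le>Suc N. if k = 0 then 0 else ?c * (?s (k - 1) * x ^ k))"
    unfolding sum_subtractf [symmetric]
    by (intro sum.cong) (simp_all add: basel_product_Suc_nth field_simps del: of_nat_Suc)
  also have "(\<Sum>k\<le>Suc N. ?s k * x ^ k) = (\<Sum>k\<le>N. ?s k * x ^ k)"
    by (simp add: basel_product_nth_eq_0)
  also have "(\<Sum>k\<le>Suc N. if k = 0 then 0 else ?c * (?s (k - 1) * x ^ k))
      = ?c * x * (\<Sum>k\<le>N. ?s k * x ^ k)"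
    by (subst sum.atMost_Suc_shift)
       (simp add: sum_distrib_left mult_ac del: of_nat_Suc)
  finally have "(\<Sum>k\<le>Suc N. basel_product (Suc N) $ k * x ^ k) =
      (\<Sum>k\<le>N. ?s k * x ^ k) * (1 - x / real (Suc N) ^ 2)"
    by (simp only: right_diff_distrib) simp
  then show ?case
    by (simp only: Suc.IH[symmetric]) simp
qed (simp add: basel_product_0)

text \<open>Up to the sign \<open>(-1)\<^sup>k\<close> the coefficient is the elementary symmetric polynomial \<open>e\<^sub>k\<close> in
  \<open>1, 1/4, \<dots>, 1/N\<^sup>2\<close>; hence it is nonnegative, and it can only grow with \<open>N\<close>.\<close>

lemma basel_product_sign: "(-1) ^ k * basel_product N $ k \<ge> 0"
proof (induction N arbitrary: k)
  case 0
  then show ?case by (cases k) (simp_all add: basel_product_0)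
next
  case (Suc N)
  show ?case
  proof (cases k)
    case 0
    then show ?thesis using Suc.IH[of 0] by (simp add: basel_product_Suc_nth)
  next
    case (Suc m)
    have "(-1) ^ m * (basel_product N $ m / real (Suc N) ^ 2) \<ge> 0"
      using Suc.IH[of m] zero_le_divide_iff[of "(-1) ^ m * basel_product N $ m" "real (Suc N) ^ 2"] by simp
    then show ?thesis
      using Suc.IH[of k] by (simp add: basel_product_Suc_nth Suc algebra_simps)
  qed
qed

lemma incseq_basel_product: "incseq (\<lambda>N. (-1) ^ k * basel_product N $ k)"
proof (rule incseq_SucI)
  fix N
  show "(-1) ^ k * basel_product N $ k \<le> (-1) ^ k * basel_product (Suc N) $ k"
  proof (cases k)
    case (Suc m)
    have "(-1) ^ m * (basel_product N $ m / real (Suc N) ^ 2) \<ge> 0"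
      using basel_product_sign[of m N] zero_le_divide_iff[of "(-1) ^ m * basel_product N $ m" "real (Suc N) ^ 2"] by simp
    then show ?thesis
      by (simp add: basel_product_Suc_nth Suc algebra_simps)
  qed (simp add: basel_product_Suc_nth)
qed

lemma basel_product_bound: "\<bar>basel_product N $ k\<bar> \<le> (\<Prod>n=1..N. 1 + 1 / real n ^ 2)"
proof (induction N arbitrary: k)
  case 0
  then show ?case by (cases k) (simp_all add: basel_product_0)
next
  case (Suc N)
  let ?P = "\<Prod>n=1..N. 1 + 1 / real n ^ 2"
  have P: "?P \<ge> 0" by (intro prod_nonneg) simp
  have "\<bar>basel_product (Suc N) $ k\<bar> \<le> \<bar>basel_product N $ k\<bar> +
      \<bar>if k = 0 then 0 else basel_product N $ (k - 1) / real (Suc N) ^ 2\<bar>"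
    unfolding basel_product_Suc_nth by (rule abs_triangle_ineq4)
  also have "\<dots> \<le> ?P + ?P / real (Suc N) ^ 2"
    using Suc.IH[of k] Suc.IH[of "k - 1"] P
    by (intro add_mono) (auto simp: abs_divide simp del: of_nat_Suc intro!: divide_right_mono)
  finally show ?case
    by (simp add: algebra_simps del: of_nat_Suc)
qed

text \<open>The bound is uniform in \<open>k\<close> as well as in \<open>N\<close>, so the series of these coefficients have a
  common geometric majorant on the unit disc.\<close>

lemma basel_product_bounded: "\<exists>M. \<forall>N k. \<bar>basel_product N $ k\<bar> \<le> M"
proof -
  have "(\<Prod>n=1..N. 1 + 1 / real n ^ 2) \<le> exp (pi\<^sup>2 / 6)" for N
  proof -
    have "(\<Sum>n=1..N. 1 / real n ^ 2) = (\<Sum>n<N. 1 / (real n + 1) ^ 2)"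
      by (rule sum.reindex_bij_witness[of _ Suc "\<lambda>n. n - 1"]) auto
    also have "\<dots> \<le> pi\<^sup>2 / 6"
      using sum_le_suminf[of "\<lambda>n. 1 / (real n + 1) ^ 2" "{..<N}"] inverse_squares_sums
      by (simp add: sums_iff add.commute)
    finally have "exp (\<Sum>n=1..N. 1 / real n ^ 2) \<le> exp (pi\<^sup>2 / 6)" by simp
    moreover have "(\<Prod>n=1..N. 1 + 1 / real n ^ 2) \<le> exp (\<Sum>n=1..N. 1 / real n ^ 2)"
      by (rule prod_le_exp_sum) simp
    ultimately show ?thesis by linarith
  qed
  then show ?thesis
    using basel_product_bound by (meson order_trans)
qed

text \<open>Pointwise convergence of polynomials on the real line does not in general carry over to their
  coefficients. Here each coefficient is, up to sign, increasing and bounded in \<open>N\<close>, hence converges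
  to some \<open>L k\<close>; Tannery's theorem allows passing to the limit inside the power series, so \<open>L\<close> gives a power series for the sine near \<open>0\<close>,
  and uniqueness of power series identifies \<open>L\<close>.\<close>

lemma basel_product_tendsto:
  "(\<lambda>N. basel_product N $ k) \<longlonglongrightarrow> (-1) ^ k * pi ^ (2 * k) / fact (2 * k + 1)"
proof -
  obtain M where M: "\<And>N k. \<bar>basel_product N $ k\<bar> \<le> M"
    using basel_product_bounded by blast
  have "\<exists>L. (\<lambda>N. basel_product N $ k) \<longlonglongrightarrow> L" for k
  proof -
    have "(-1) ^ k * basel_product N $ k \<le> M" for N
      using M[of N k] basel_product_sign[of k N] by (simp add: abs_mult minus_one_power_iff split: if_splits)
    then obtain L where "(\<lambda>N. (-1) ^ k * basel_product N $ k) \<longlonglongrightarrow> L"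
      using incseq_convergent[OF incseq_basel_product, of k] by metis
    from tendsto_mult_left[OF this, of "(-1) ^ k"] show ?thesis
      by (auto simp flip: mult.assoc power_add simp: mult_2[symmetric])
  qed
  then obtain L where L: "\<And>k. (\<lambda>N. basel_product N $ k) \<longlonglongrightarrow> L k"
    by metis
  have sums: "(\<lambda>k. pi * L k * x ^ (2 * k + 1)) sums sin (pi * x)" if x: "\<bar>x\<bar> < 1" for x
  proof -
    have geo: "summable (\<lambda>k. M * (x ^ 2) ^ k)"
      using x by (intro summable_mult summable_geometric) (simp add: abs_square_less_1)
    have bd: "norm (basel_product N $ k * (x ^ 2) ^ k) \<le> M * (x ^ 2) ^ k" for N k
      using M[of N k] by (simp add: abs_mult mult_right_mono)
    have lim: "(\<lambda>N. basel_product N $ k * (x ^ 2) ^ k) \<longlonglongrightarrow> L k * (x ^ 2) ^ k" for k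
      by (intro tendsto_mult_right L)
    have "eventually (\<lambda>(k, N). norm (basel_product N $ k * (x ^ 2) ^ k) \<le> M * (x ^ 2) ^ k)
        (sequentially \<times>\<^sub>F sequentially)"
      using bd by (intro always_eventually) force
    from tannerys_theorem[OF lim this geo sequentially_bot]
    have sm: "summable (\<lambda>k. norm (L k * (x ^ 2) ^ k))"
      and "(\<lambda>N. \<Sum>k. basel_product N $ k * (x ^ 2) ^ k) \<longlonglongrightarrow> (\<Sum>k. L k * (x ^ 2) ^ k)"
      by blast+
    note this(2)
    moreover have "(\<Sum>k. basel_product N $ k * (x ^ 2) ^ k) = (\<Prod>n=1..N. 1 - x ^ 2 / real n ^ 2)" for N
      unfolding basel_product_eval
      by (rule suminf_finite) (auto simp: basel_product_nth_eq_0)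
    ultimately have "(\<lambda>N. pi * x * (\<Prod>n=1..N. 1 - x ^ 2 / real n ^ 2)) \<longlonglongrightarrow>
        pi * x * (\<Sum>k. L k * (x ^ 2) ^ k)"
      by (auto intro: tendsto_mult_left)
    then have "pi * x * (\<Sum>k. L k * (x ^ 2) ^ k) = sin (pi * x)"
      using sin_product_formula_real[of x] LIMSEQ_unique by blast
    moreover have "(\<lambda>k. pi * x * (L k * (x ^ 2) ^ k)) sums (pi * x * (\<Sum>k. L k * (x ^ 2) ^ k))"
      using sm by (intro sums_mult summable_sums) (rule summable_norm_cancel)
    moreover have "pi * x * (L k * (x ^ 2) ^ k) = pi * L k * x ^ (2 * k + 1)" for k
      by (simp add: power_mult)
    ultimately show ?thesis
      by simp
  qed
  define F where "F = Abs_fps (\<lambda>n. if odd n then pi * L (n div 2) else 0)"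
  have F_sums: "(\<lambda>n. F $ n * x ^ n) sums sin (pi * x)" if x: "\<bar>x\<bar> < 1" for x
  proof -
    have zero: "F $ n * x ^ n = 0" if "n \<notin> range (\<lambda>k. 2 * k + 1)" for n
      using that by (cases "odd n") (auto simp: F_def elim!: oddE)
    have "strict_mono (\<lambda>k :: nat. 2 * k + 1)"
      by (simp add: strict_mono_def)
    then have "(\<lambda>k. F $ (2 * k + 1) * x ^ (2 * k + 1)) sums sin (pi * x) \<longleftrightarrow>
        (\<lambda>n. F $ n * x ^ n) sums sin (pi * x)"
      by (rule sums_mono_reindex) (rule zero)
    then show ?thesis using sums[OF x] by (simp add: F_def)
  qed
  have zero_sums: "(\<lambda>n. (F $ n - fps_sin pi $ n) * (x - 0) ^ n) sums 0" if x: "norm (x - 0) < 1" for x :: real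
  proof -
    have "(\<lambda>n. fps_sin pi $ n * x ^ n) sums sin (pi * x)"
      using sums_eval_fps[of x "fps_sin pi"] by simp
    then show ?thesis
      using sums_diff[OF F_sums[of x]] x by (simp only: left_diff_distrib) force
  qed
  have "F = fps_sin pi"
  proof (rule fps_ext, rule ccontr)
    fix n assume n: "F $ n \<noteq> fps_sin pi $ n"
    then have "n > 0" by (cases n) (auto simp: F_def)
    have "F $ n - fps_sin pi $ n \<noteq> 0" using n by simp
    from powser_0_nonzero[OF zero_less_one zero_sums refl this \<open>n > 0\<close>]
    obtain s where s: "0 < s" "\<And>z :: real. z \<in> cball 0 s - {0} \<Longrightarrow> (0 :: real) \<noteq> 0"
      by blast
    from s(2)[of s] s(1) show False by simp
  qed
  then have "F $ (2 * k + 1) = fps_sin pi $ (2 * k + 1)" by simp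
  then have "pi * L k = pi * ((-1) ^ k * pi ^ (2 * k) / fact (2 * k + 1))"
    by (simp add: F_def fps_sin_def del: fact_Suc)
  then have "L k = (-1) ^ k * pi ^ (2 * k) / fact (2 * k + 1)"
    unfolding mult_cancel_left using pi_neq_zero by blast
  with L[of k] show ?thesis by (simp only:)
qed

section \<open>Identities between finite products\<close>

primrec factor_prod :: "(nat \<Rightarrow> 'a :: comm_ring_1) \<Rightarrow> nat \<Rightarrow> 'a" where
  "factor_prod a 0 = 1"
| "factor_prod a (Suc N) = factor_prod a N * (1 - a (Suc N))"

text \<open>For \<open>a n = x / n\<^sup>2\<close> this is \<open>x\<close> times the derivative of the product with respect to \<open>x\<close>.\<close>

primrec factor_euler :: "(nat \<Rightarrow> 'a :: comm_ring_1) \<Rightarrow> nat \<Rightarrow> 'a" where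
  "factor_euler a 0 = 0"
| "factor_euler a (Suc N) = factor_euler a N * (1 - a (Suc N)) - a (Suc N) * factor_prod a N"

text \<open>The product times \<open>\<Sum>n (-1)\<^sup>n a n / (1 - a n)\<close>, with the denominators cancelled so that it makes
  sense in every commutative ring.\<close>

primrec factor_alternating :: "(nat \<Rightarrow> 'a :: comm_ring_1) \<Rightarrow> nat \<Rightarrow> 'a" where
  "factor_alternating a 0 = 0"
| "factor_alternating a (Suc N) = factor_alternating a N * (1 - a (Suc N)) + (-1) ^ Suc N * a (Suc N) * factor_prod a N"

text \<open>Divide by both products: the right-hand side becomes \<open>2 \<Sum>n\<le>N. b n / (1 - b n)\<close>, twice the
  even-indexed terms, minus \<open>\<Sum>n\<le>2N. a n / (1 - a n)\<close>. This is how an alternating sum is reduced to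
  logarithmic derivatives.\<close>

lemma alternating_parity_split:
  assumes "\<And>n. b n = a (2 * n)"
  shows "factor_prod b N * factor_alternating a (2 * N) =
    factor_prod b N * factor_euler a (2 * N) - 2 * factor_euler b N * factor_prod a (2 * N)"
proof (induction N)
  case (Suc N)
  define x where "x = a (Suc (2 * N))"
  define y where "y = a (Suc (Suc (2 * N)))"
  have b: "b (Suc N) = y" by (simp add: assms y_def)
  have e: "2 * Suc N = Suc (Suc (2 * N))" by simp
  have step: "p * (1 - y) * ((q * (1 - x) - x * s) * (1 - y) + y * (s * (1 - x))) =
     p * (1 - y) * ((d * (1 - x) - x * s) * (1 - y) - y * (s * (1 - x))) -
     2 * (d' * (1 - y) - y * p) * (s * (1 - x) * (1 - y))"
    if "p * q = p * d - 2 * d' * s" for p q d d' s :: 'a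
  proof -
    have "p * (1 - y) * ((q * (1 - x) - x * s) * (1 - y) + y * (s * (1 - x))) =
      (p * q) * ((1 - y) * (1 - x) * (1 - y)) + p * (1 - y) * (y * (s * (1 - x)) - x * s * (1 - y))"
      by (simp add: algebra_simps)
    then show ?thesis unfolding that by (simp add: algebra_simps)
  qed
  show ?case
    unfolding e using step[OF Suc.IH] by (simp add: b flip: x_def y_def)
qed simp

text \<open>The recursions for \<open>G0\<close> and \<open>G1\<close> say that \<open>G0 + y G1\<close> is \<open>\<Prod>n (1 + v (1 + (-1)\<^sup>n y) g n)\<close> modulo
  \<open>y\<^sup>2\<close>. Multiplying a factor without \<open>y\<close> by \<open>1 - a n\<close> turns it into \<open>1 - b n\<close>; the extra factor
  \<open>1 - v\<close> in the second claim converts the \<open>a n\<close> of the distinguished index into \<open>b n\<close>.\<close>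

lemma one_sign_products:
  fixes a g :: "nat \<Rightarrow> 'a :: comm_ring_1"
  assumes g: "\<And>n. g n * (1 - a n) = a n"
  assumes b: "\<And>n. b n = (1 - v) * a n"
  assumes G0: "G0 0 = 1" "\<And>N. G0 (Suc N) = G0 N + v * g (Suc N) * G0 N"
  assumes G1: "G1 0 = 0"
    "\<And>N. G1 (Suc N) = G1 N + v * g (Suc N) * (G1 N + (-1) ^ Suc N * G0 N)"
  shows "G0 N * factor_prod a N = factor_prod b N"
    and "(1 - v) * (G1 N * factor_prod a N) = v * factor_alternating b N"
proof -
  show 0: "G0 N * factor_prod a N = factor_prod b N" for N
  proof (induction N)
    case (Suc N)
    have "G0 (Suc N) * factor_prod a (Suc N) =
        (G0 N * factor_prod a N) * (1 - a (Suc N) + v * (g (Suc N) * (1 - a (Suc N))))"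
      by (simp add: G0 algebra_simps)
    also have "\<dots> = factor_prod b (Suc N)"
      unfolding Suc.IH g by (simp add: b algebra_simps)
    finally show ?case .
  qed (simp add: G0)
  show "(1 - v) * (G1 N * factor_prod a N) = v * factor_alternating b N"
  proof (induction N)
    case (Suc N)
    have "(1 - v) * (G1 (Suc N) * factor_prod a (Suc N)) =
        ((1 - v) * (G1 N * factor_prod a N)) * (1 - a (Suc N) + v * (g (Suc N) * (1 - a (Suc N))))
        + v * (1 - v) * (-1) ^ Suc N * (g (Suc N) * (1 - a (Suc N))) * (G0 N * factor_prod a N)"
      by (simp add: G1 algebra_simps)
    also have "\<dots> = v * factor_alternating b (Suc N)"
      unfolding Suc.IH g 0 by (simp add: b algebra_simps)
    finally show ?case .
  qed (simp add: G1)
qed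

text \<open>The product for \<open>c\<close> consists of the even factors of the product for \<open>b\<close>, so it cancels against
  them and leaves the odd factors that the signs \<open>(-1)\<^sup>n\<close> call for.\<close>

lemma all_signs_products:
  fixes a g :: "nat \<Rightarrow> 'a :: comm_ring_1"
  assumes g: "\<And>n. g n * (1 - a n) = a n"
  assumes b: "\<And>n. b n = (1 + v) * a n"
  assumes c: "\<And>n. c n = b (2 * n)"
  assumes d: "\<And>n. d n = (1 - v) * a (2 * n)"
  assumes G: "G 0 = 1" "\<And>N. G (Suc N) = G N + v * g (Suc N) * ((-1) ^ Suc N * G N)"
  shows "G (2 * N) * factor_prod a (2 * N) * factor_prod c N = factor_prod d N * factor_prod b (2 * N)"
proof (induction N)
  case (Suc N)
  define m where "m = 2 * N"
  have e: "2 * Suc N = Suc (Suc m)" by (simp add: m_def)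
  define x where "x = a (Suc m)"
  define y where "y = a (Suc (Suc m))"
  define p where "p = g (Suc m)"
  define q where "q = g (Suc (Suc m))"
  have px: "p * (1 - x) = x" and qy: "q * (1 - y) = y"
    using g[of "Suc m"] g[of "Suc (Suc m)"] by (simp_all add: p_def q_def x_def y_def)
  have x: "(1 - v * p) * (1 - x) = 1 - (1 + v) * x"
  proof -
    have "(1 - v * p) * (1 - x) = 1 - x - v * (p * (1 - x))" by (simp add: algebra_simps)
    also have "\<dots> = 1 - (1 + v) * x" unfolding px by (simp add: algebra_simps)
    finally show ?thesis .
  qed
  have y: "(1 + v * q) * (1 - y) = 1 - (1 - v) * y"
  proof -
    have "(1 + v * q) * (1 - y) = 1 - y + v * (q * (1 - y))" by (simp add: algebra_simps)
    also have "\<dots> = 1 - (1 - v) * y" unfolding qy by (simp add: algebra_simps)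
    finally show ?thesis .
  qed
  have sgn: "(-1) ^ Suc m = (-1 :: 'a)" "(-1) ^ Suc (Suc m) = (1 :: 'a)" by (simp_all add: m_def)
  have c': "c (Suc N) = (1 + v) * y" and d': "d (Suc N) = (1 - v) * y"
    unfolding c d b e y_def by (rule refl)+
  have "G (Suc (Suc m)) = G m * (1 - v * p) * (1 + v * q)"
    unfolding G(2) sgn p_def q_def by (simp add: algebra_simps)
  then have "G (2 * Suc N) * factor_prod a (2 * Suc N) * factor_prod c (Suc N) =
     (G m * factor_prod a m * factor_prod c N) * ((1 - v * p) * (1 - x)) * ((1 + v * q) * (1 - y)) *
     (1 - (1 + v) * y)"
    unfolding e factor_prod.simps c' by (simp only: x_def y_def mult_ac)
  also have "\<dots> = factor_prod d (Suc N) * factor_prod b (2 * Suc N)"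
    unfolding e factor_prod.simps d' b x_def [symmetric] y_def [symmetric] x y Suc.IH [folded m_def]
    by (simp only: mult_ac)
  finally show ?case .
qed (simp add: G)

section \<open>Truncated Euler sums\<close>

definition decreasing_lists :: "nat \<Rightarrow> nat \<Rightarrow> nat list set" where
  "decreasing_lists N d = {n. length n = d \<and> set n \<subseteq> {1..N} \<and> sorted_wrt (>) n}"

definition truncated_sum :: "nat \<Rightarrow> nat list \<Rightarrow> int list \<Rightarrow> real" where
  "truncated_sum N s e = (\<Sum>n\<in>decreasing_lists N (length s).
     \<Prod>i<length s. of_int (e ! i) ^ (n ! i) / real (n ! i) ^ (s ! i))"

lemma euler_sum_eq_lim: "euler_sum s e = lim (\<lambda>N. truncated_sum N s e)"
  by (simp add: euler_sum_def truncated_sum_def decreasing_lists_def)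

lemma finite_decreasing_lists: "finite (decreasing_lists N d)"
  by (rule finite_subset[OF _ finite_lists_length_eq[of "{1..N}" d]]) (auto simp: decreasing_lists_def)

text \<open>The only entry of a decreasing list that can equal the new bound is the first one. All
  recursions in the truncation bound come from this.\<close>

lemma decreasing_lists_Suc:
  "decreasing_lists (Suc N) (Suc d) =
     decreasing_lists N (Suc d) \<union> (#) (Suc N) ` decreasing_lists N d"
proof (intro equalityI subsetI)
  fix l assume l: "l \<in> decreasing_lists (Suc N) (Suc d)"
  then obtain n m where nm: "l = n # m" by (cases l) (auto simp: decreasing_lists_def)
  have m: "\<forall>x\<in>set m. x < n \<and> 1 \<le> x" and n: "n \<le> Suc N" "1 \<le> n"
    using l by (auto simp: nm decreasing_lists_def)
  show "l \<in> decreasing_lists N (Suc d) \<union> (#) (Suc N) ` decreasing_lists N d"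
  proof (cases "n = Suc N")
    case True
    then have "m \<in> decreasing_lists N d"
      using l m by (fastforce simp: nm decreasing_lists_def)
    then show ?thesis by (simp add: nm True)
  next
    case False
    then show ?thesis
      using l m n by (fastforce simp: nm decreasing_lists_def)
  qed
qed (fastforce simp: decreasing_lists_def)

lemma truncated_sum_Nil [simp]: "truncated_sum N [] e = 1"
proof -
  have "decreasing_lists N 0 = {[]}" by (auto simp: decreasing_lists_def)
  then show ?thesis by (simp add: truncated_sum_def)
qed

lemma truncated_sum_0 [simp]: "truncated_sum 0 (a # s) e = 0"
  by (auto simp: truncated_sum_def decreasing_lists_def intro!: sum.neutral)

lemma truncated_sum_Suc:
  "truncated_sum (Suc N) (a # s) (b # e) =
     truncated_sum N (a # s) (b # e) + of_int b ^ Suc N / real (Suc N) ^ a * truncated_sum N s e"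
proof -
  have *: "decreasing_lists N (Suc d) \<inter> (#) (Suc N) ` decreasing_lists N d = {}" for d
    by (auto simp: decreasing_lists_def)
  show ?thesis
    unfolding truncated_sum_def length_Cons decreasing_lists_Suc
    by (subst sum.union_disjoint)
       (auto simp: * finite_decreasing_lists sum.reindex prod.lessThan_Suc_shift sum_distrib_left
             simp del: of_nat_Suc power_Suc prod.lessThan_Suc)
qed

lemma truncated_sum_eq_sum:
  "truncated_sum N (a # s) (b # e) =
     (\<Sum>n<N. of_int b ^ Suc n / real (Suc n) ^ a * truncated_sum n s e)"
  by (induction N) (simp_all add: truncated_sum_Suc del: of_nat_Suc power_Suc)

text \<open>By induction the inner truncated sums converge, hence are bounded, and the outer series is
  dominated by \<open>\<Sum>n 1/n\<^sup>2\<close>.\<close>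

lemma convergent_truncated_sum:
  assumes "length e = length s" "\<forall>a\<in>set s. 2 \<le> a" "set e \<subseteq> {1, -1}"
  shows "convergent (\<lambda>N. truncated_sum N s e)"
  using assms
proof (induction e s rule: list_induct2)
  case (Cons b e a s)
  then have "convergent (\<lambda>N. truncated_sum N s e)" by simp
  then obtain K where K: "\<And>N. \<bar>truncated_sum N s e\<bar> \<le> K"
    using convergent_imp_Bseq Bseq_def by (metis real_norm_def)
  have "norm (of_int b ^ Suc n / real (Suc n) ^ a * truncated_sum n s e)
      \<le> K * (1 / (real n + 1) ^ 2)" for n
  proof -
    have "\<bar>of_int b :: real\<bar> = 1" using Cons.prems by auto
    then have "norm (of_int b ^ Suc n / real (Suc n) ^ a * truncated_sum n s e)
        = \<bar>truncated_sum n s e\<bar> * (1 / real (Suc n) ^ a)"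
      by (simp add: abs_mult power_abs del: of_nat_Suc power_Suc)
    also have "\<dots> \<le> K * (1 / real (Suc n) ^ 2)"
    proof (rule mult_mono)
      have "real (Suc n) ^ 2 \<le> real (Suc n) ^ a"
        using Cons.prems by (intro power_increasing) auto
      then show "1 / real (Suc n) ^ a \<le> 1 / real (Suc n) ^ 2"
        by (intro divide_left_mono) auto
    qed (use K[of 0] K[of n] in auto)
    finally show ?thesis by (simp add: add.commute)
  qed
  moreover have "summable (\<lambda>n. K * (1 / (real n + 1) ^ 2))"
    using inverse_squares_sums by (intro summable_mult) (auto simp: sums_iff add.commute)
  ultimately have "summable (\<lambda>n. of_int b ^ Suc n / real (Suc n) ^ a * truncated_sum n s e)"
    by (rule summable_comparison_test'[rotated])
  then show ?case
    unfolding truncated_sum_eq_sum by (simp add: summable_iff_convergent)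
qed (simp add: convergent_const)

definition truncated_A :: "nat \<Rightarrow> nat \<Rightarrow> nat \<Rightarrow> nat \<Rightarrow> real" where
  "truncated_A N \<alpha> n d = (\<Sum>(j, e)\<in>A_index \<alpha> (2 * n) d. truncated_sum N (map (\<lambda>x. 2 * x) j) e)"

lemma truncated_A_tendsto: "(\<lambda>N. truncated_A N \<alpha> n d) \<longlonglongrightarrow> A \<alpha> (2 * n) d"
  unfolding truncated_A_def A_def
proof (intro tendsto_sum, clarify)
  fix j e assume "(j, e) \<in> A_index \<alpha> (2 * n) d"
  then have "convergent (\<lambda>N. truncated_sum N (map (\<lambda>x. 2 * x) j) e)"
    by (intro convergent_truncated_sum) (auto simp: A_index_def)
  then show "(\<lambda>N. truncated_sum N (map (\<lambda>x. 2 * x) j) e) \<longlonglongrightarrow> euler_sum (map (\<lambda>x. 2 * x) j) e"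
    unfolding euler_sum_eq_lim by (rule convergent_LIMSEQ_iff[THEN iffD1])
qed

lemma A_index_0: "A_index \<alpha> (2 * n) 0 = (if n = 0 \<and> \<alpha> = 0 then {([], [])} else {})"
  by (auto simp: A_index_def)

lemma A_index_Suc:
  "A_index \<alpha> (2 * n) (Suc d) = (\<Union>i\<in>{1..n}.
     (\<lambda>(j, e). (i # j, 1 # e)) ` A_index \<alpha> (2 * (n - i)) d \<union>
     (\<lambda>(j, e). (i # j, -1 # e)) ` (if \<alpha> = 0 then {} else A_index (\<alpha> - 1) (2 * (n - i)) d))"
  (is "?L = ?R")
proof (intro equalityI subsetI)
  fix p assume p: "p \<in> ?L"
  then obtain i j b e where q: "p = (i # j, b # e)"
    by (cases p) (auto simp: A_index_def length_Suc_conv)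
  have i: "i \<in> {1..n}" using p by (auto simp: q A_index_def)
  consider "b = 1" | "b = -1" using p by (auto simp: q A_index_def)
  then show "p \<in> ?R"
  proof cases
    case 1
    then have "(j, e) \<in> A_index \<alpha> (2 * (n - i)) d" using p by (auto simp: q A_index_def)
    then have "p \<in> (\<lambda>(j, e). (i # j, 1 # e)) ` A_index \<alpha> (2 * (n - i)) d"
      by (rule rev_image_eqI) (simp add: q 1)
    then show ?thesis using i by blast
  next
    case 2
    then have "(j, e) \<in> A_index (\<alpha> - 1) (2 * (n - i)) d" "\<alpha> \<noteq> 0" using p by (auto simp: q A_index_def)
    then have "p \<in> (\<lambda>(j, e). (i # j, -1 # e)) ` (if \<alpha> = 0 then {} else A_index (\<alpha> - 1) (2 * (n - i)) d)"
      by (intro image_eqI[of _ _ "(j, e)"]) (simp_all add: q 2)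
    then show ?thesis using i by blast
  qed
next
  fix p assume "p \<in> ?R"
  then show "p \<in> ?L" by (auto simp: A_index_def split: if_splits)
qed

lemma sum_A_index_Suc:
  "(\<Sum>(j, e)\<in>A_index \<alpha> (2 * n) (Suc d). f j e) = (\<Sum>i=1..n.
     (\<Sum>(j, e)\<in>A_index \<alpha> (2 * (n - i)) d. f (i # j) (1 # e)) +
     (if \<alpha> = 0 then 0 else \<Sum>(j, e)\<in>A_index (\<alpha> - 1) (2 * (n - i)) d. f (i # j) (-1 # e)))"
proof -
  define P where "P i = A_index \<alpha> (2 * (n - i)) d" for i
  define M where "M i = (if \<alpha> = 0 then {} else A_index (\<alpha> - 1) (2 * (n - i)) d)" for i
  have fin: "finite (P i)" "finite (M i)" for i
    by (auto simp: P_def M_def finite_A_index)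
  have inj: "inj_on (\<lambda>(j, e). (i # j, b # e)) X"
    for i :: nat and b :: int and X
    by (auto simp: inj_on_def)
  have img: "(\<Sum>(j, e)\<in>(\<lambda>(j, e). (i # j, b # e)) ` X. f j e) = (\<Sum>(j, e)\<in>X. f (i # j) (b # e))"
    for i b X
    by (subst sum.reindex[OF inj]) (simp add: case_prod_unfold o_def)
  have "(\<Sum>(j, e)\<in>A_index \<alpha> (2 * n) (Suc d). f j e) =
     (\<Sum>i=1..n. \<Sum>(j, e)\<in>(\<lambda>(j, e). (i # j, 1 # e)) ` P i \<union> (\<lambda>(j, e). (i # j, -1 # e)) ` M i. f j e)"
    unfolding A_index_Suc P_def [symmetric] M_def [symmetric]
    by (rule sum.UNION_disjoint) (auto simp: fin)
  also have "\<dots> = (\<Sum>i=1..n. (\<Sum>(j, e)\<in>P i. f (i # j) (1 # e)) + (\<Sum>(j, e)\<in>M i. f (i # j) (-1 # e)))"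
    unfolding img [symmetric]
    by (intro sum.cong refl sum.union_disjoint) (auto simp: fin)
  also have "\<dots> = (\<Sum>i=1..n. (\<Sum>(j, e)\<in>P i. f (i # j) (1 # e)) + (if \<alpha> = 0 then 0 else
      \<Sum>(j, e)\<in>A_index (\<alpha> - 1) (2 * (n - i)) d. f (i # j) (-1 # e)))"
    by (intro sum.cong) (auto simp: M_def)
  finally show ?thesis unfolding P_def .
qed

lemma truncated_A_Suc:
  "truncated_A (Suc N) \<alpha> n (Suc d) = truncated_A N \<alpha> n (Suc d) +
     (\<Sum>i=1..n. (1 / real (Suc N) ^ 2) ^ i * (truncated_A N \<alpha> (n - i) d +
        (-1) ^ Suc N * (if \<alpha> = 0 then 0 else truncated_A N (\<alpha> - 1) (n - i) d)))"
proof -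
  let ?t = "\<lambda>N j e. truncated_sum N (map (\<lambda>x. 2 * x) j) e"
  have c: "1 / real (Suc N) ^ (2 * i) = (1 / real (Suc N) ^ 2) ^ i" for i
    by (simp add: power_mult power_divide del: of_nat_Suc)
  have plus: "(\<Sum>(j, e)\<in>X. ?t (Suc N) (i # j) (1 # e)) =
      (\<Sum>(j, e)\<in>X. ?t N (i # j) (1 # e)) + (1 / real (Suc N) ^ 2) ^ i * (\<Sum>(j, e)\<in>X. ?t N j e)"
    for i X unfolding c [symmetric]
    by (simp add: truncated_sum_Suc case_prod_unfold sum.distrib sum_distrib_left
             del: of_nat_Suc power_Suc)
  have minus: "(\<Sum>(j, e)\<in>X. ?t (Suc N) (i # j) (-1 # e)) = (\<Sum>(j, e)\<in>X. ?t N (i # j) (-1 # e)) +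
      (1 / real (Suc N) ^ 2) ^ i * ((-1) ^ Suc N * (\<Sum>(j, e)\<in>X. ?t N j e))"
    for i X unfolding c [symmetric]
    by (simp add: truncated_sum_Suc case_prod_unfold sum.distrib sum_distrib_left
             del: of_nat_Suc power_Suc)
  have collect: "(a + c * b) + (a' + c * (s * b')) = (a + a') + c * (b + s * b')"
    "(a + c * b) + 0 = (a + 0) + c * (b + s * 0)"
    for a a' b b' c s :: real
    by (simp_all add: algebra_simps)
  show ?thesis
    unfolding truncated_A_def sum_A_index_Suc sum.distrib [symmetric]
    by (cases "\<alpha> = 0") (simp_all only: plus minus if_True if_False simp_thms add_0_right mult_zero_right collect)
qed

lemma truncated_A_at_0: "truncated_A 0 \<alpha> n d = (if \<alpha> = 0 \<and> n = 0 \<and> d = 0 then 1 else 0)"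
proof (cases d)
  case (Suc d')
  show ?thesis unfolding Suc truncated_A_def sum_A_index_Suc by (simp cong: if_cong)
qed (auto simp: truncated_A_def A_index_0)

lemma truncated_A_depth_0: "truncated_A N \<alpha> n 0 = (if \<alpha> = 0 \<and> n = 0 then 1 else 0)"
  by (auto simp: truncated_A_def A_index_0)

lemma A_index_empty: "d < \<alpha> \<or> n < d \<Longrightarrow> A_index \<alpha> (2 * n) d = {}"
proof (rule equals0I, clarify)
  fix j e assume *: "d < \<alpha> \<or> n < d" and je: "(j, e) \<in> A_index \<alpha> (2 * n) d"
  have "length j \<le> sum_list j" if "\<forall>x\<in>set j. x > 0" for j :: "nat list"
    using that by (induction j) auto
  then show False
    using * je count_le_length[of e "-1"] by (force simp: A_index_def)
qed

section \<open>Coefficientwise limits of series in two variables\<close>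

definition coeff_tendsto :: "(nat \<Rightarrow> real fps fps) \<Rightarrow> real fps fps \<Rightarrow> bool" where
  "coeff_tendsto F G \<longleftrightarrow> (\<forall>n d. (\<lambda>N. F N $ n $ d) \<longlonglongrightarrow> G $ n $ d)"

lemma coeff_tendsto_const: "coeff_tendsto (\<lambda>_. F) F"
  by (simp add: coeff_tendsto_def)

lemma coeff_tendsto_diff:
  "coeff_tendsto F F' \<Longrightarrow> coeff_tendsto G G' \<Longrightarrow> coeff_tendsto (\<lambda>N. F N - G N) (F' - G')"
  by (auto simp: coeff_tendsto_def intro!: tendsto_diff)

lemma coeff_tendsto_mult:
  "coeff_tendsto F F' \<Longrightarrow> coeff_tendsto G G' \<Longrightarrow> coeff_tendsto (\<lambda>N. F N * G N) (F' * G')"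
  by (auto simp: coeff_tendsto_def fps_mult_nth fps_sum_nth intro!: tendsto_sum tendsto_mult)

lemma coeff_tendsto_double:
  "coeff_tendsto F G \<Longrightarrow> coeff_tendsto (\<lambda>N. F (2 * N)) G"
  by (auto simp: coeff_tendsto_def intro: LIMSEQ_subseq_LIMSEQ[unfolded o_def] simp: strict_mono_def)

lemma coeff_tendsto_unique:
  "coeff_tendsto F G \<Longrightarrow> coeff_tendsto F G' \<Longrightarrow> G = G'"
  unfolding coeff_tendsto_def fps_eq_iff using LIMSEQ_unique by blast

text \<open>The factor belonging to \<open>n\<close> in \<open>P(wu)\<close> is \<open>1 - sq_term w n\<close>.\<close>

definition sq_term :: "real fps \<Rightarrow> nat \<Rightarrow> real fps fps" where
  "sq_term w n = fps_const (w * fps_const (1 / real n ^ 2)) * fps_X"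

text \<open>The series \<open>sin (\<pi> \<surd>(wu)) / (\<pi> \<surd>(wu))\<close>.\<close>

definition sinc :: "real fps \<Rightarrow> real fps fps" where
  "sinc w = Abs_fps (\<lambda>k. fps_const ((-1) ^ k * pi ^ (2 * k) / fact (2 * k + 1)) * w ^ k)"

lemma factor_prod_sq_term_nth: "factor_prod (sq_term w) N $ k = fps_const (basel_product N $ k) * w ^ k"
proof (induction N arbitrary: k)
  case 0
  then show ?case by (simp add: basel_product_0)
next
  case (Suc N)
  have "factor_prod (sq_term w) (Suc N) = factor_prod (sq_term w) N -
      fps_const (w * fps_const (1 / real (Suc N) ^ 2)) * (fps_X * factor_prod (sq_term w) N)"
    by (simp add: sq_term_def algebra_simps del: of_nat_Suc)
  then have "factor_prod (sq_term w) (Suc N) $ k = factor_prod (sq_term w) N $ k -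
      (if k = 0 then 0 else w * fps_const (1 / real (Suc N) ^ 2) * factor_prod (sq_term w) N $ (k - 1))"
    by (simp del: of_nat_Suc)
  also have "\<dots> = fps_const (basel_product (Suc N) $ k) * w ^ k"
  proof (cases k)
    case (Suc m)
    have "fps_const (basel_product N $ m / real (Suc N) ^ 2) =
        fps_const (basel_product N $ m) * fps_const (1 / real (Suc N) ^ 2)"
      by (simp del: of_nat_Suc)
    then have *: "fps_const (basel_product (Suc N) $ k) = fps_const (basel_product N $ k) -
        fps_const (basel_product N $ m) * fps_const (1 / real (Suc N) ^ 2)"
      by (simp only: Suc basel_product_Suc_nth fps_const_sub [symmetric] nat.distinct if_False diff_Suc_1)
    show ?thesis
      unfolding * left_diff_distrib Suc.IH by (simp add: Suc mult_ac)
  qed (simp add: Suc.IH basel_product_Suc_nth)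
  finally show ?case .
qed

lemma factor_euler_sq_term: "factor_euler (sq_term w) N = fps_X * fps_deriv (factor_prod (sq_term w) N)"
proof (induction N)
  case (Suc N)
  have "fps_X * fps_deriv (sq_term w n) = sq_term w n" for n
    by (simp add: sq_term_def mult_ac)
  then have "fps_X * fps_deriv (factor_prod (sq_term w) (Suc N)) =
      fps_X * fps_deriv (factor_prod (sq_term w) N) * (1 - sq_term w (Suc N)) - sq_term w (Suc N) * factor_prod (sq_term w) N"
    by (simp add: algebra_simps)
  then show ?case by (simp add: Suc.IH)
qed simp

lemma coeff_tendsto_factor_prod_sq_term: "coeff_tendsto (factor_prod (sq_term w)) (sinc w)"
  unfolding coeff_tendsto_def
proof (intro allI)
  fix n d
  have "(\<lambda>N. basel_product N $ n * (w ^ n) $ d) \<longlonglongrightarrow>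
      (-1) ^ n * pi ^ (2 * n) / fact (2 * n + 1) * (w ^ n) $ d"
    by (intro tendsto_mult_right basel_product_tendsto)
  then show "(\<lambda>N. factor_prod (sq_term w) N $ n $ d) \<longlonglongrightarrow> sinc w $ n $ d"
    by (simp only: factor_prod_sq_term_nth sinc_def fps_nth_Abs_fps fps_mult_left_const_nth)
qed

lemma coeff_tendsto_factor_euler_sq_term:
  "coeff_tendsto (factor_euler (sq_term w)) (fps_X * fps_deriv (sinc w))"
proof -
  have "coeff_tendsto (\<lambda>N. fps_deriv (factor_prod (sq_term w) N)) (fps_deriv (sinc w))"
    unfolding coeff_tendsto_def
  proof (intro allI)
    fix n d
    have *: "fps_deriv F $ n $ d = real (n + 1) * F $ (n + 1) $ d" for F :: "real fps fps"
      by (simp add: fps_of_nat [symmetric] del: fps_of_nat of_nat_Suc)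
    show "(\<lambda>N. fps_deriv (factor_prod (sq_term w) N) $ n $ d) \<longlonglongrightarrow> fps_deriv (sinc w) $ n $ d"
      unfolding *
      using coeff_tendsto_factor_prod_sq_term[of w] by (intro tendsto_mult_left) (simp add: coeff_tendsto_def)
  qed
  moreover have "factor_euler (sq_term w) = (\<lambda>N. fps_X * fps_deriv (factor_prod (sq_term w) N))"
    by (rule ext) (rule factor_euler_sq_term)
  ultimately show ?thesis
    by (simp only: coeff_tendsto_mult coeff_tendsto_const)
qed

section \<open>Generating series of the truncated sums\<close>

text \<open>The empty index, of depth \<open>0\<close>, is kept here, in contrast to \<^const>\<open>gen_series\<close>: the recursions
  in \<open>N\<close> start from it.\<close>

definition truncated_series :: "nat \<Rightarrow> nat \<Rightarrow> real fps fps" where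
  "truncated_series \<alpha> N = Abs_fps (\<lambda>n. Abs_fps (\<lambda>d. truncated_A N \<alpha> n d))"

definition truncated_diagonal :: "nat \<Rightarrow> real fps fps" where
  "truncated_diagonal N = Abs_fps (\<lambda>n. Abs_fps (\<lambda>d. truncated_A N d n d))"

text \<open>The expansion of \<open>(u / n\<^sup>2) / (1 - u / n\<^sup>2)\<close>.\<close>

definition geometric_tail :: "nat \<Rightarrow> real fps fps" where
  "geometric_tail n = Abs_fps (\<lambda>k. if k = 0 then 0 else fps_const ((1 / real n ^ 2) ^ k))"

definition v_var :: "real fps fps" where
  "v_var = fps_const fps_X"

lemma geometric_tail_mult_one_minus: "geometric_tail n * (1 - sq_term 1 n) = sq_term 1 n"
proof (rule fps_ext)
  fix k
  have "geometric_tail n * (1 - sq_term 1 n) = geometric_tail n - fps_const (fps_const (1 / real n ^ 2)) * (fps_X * geometric_tail n)"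
    by (simp add: sq_term_def algebra_simps)
  then have "(geometric_tail n * (1 - sq_term 1 n)) $ k = geometric_tail n $ k -
      (if k = 0 then 0 else fps_const (1 / real n ^ 2) * geometric_tail n $ (k - 1))"
    by simp
  also have "\<dots> = sq_term 1 n $ k"
    by (cases k) (auto simp: geometric_tail_def sq_term_def)
  finally show "(geometric_tail n * (1 - sq_term 1 n)) $ k = sq_term 1 n $ k" .
qed

lemma v_var_mult_geometric_tail_mult_nth:
  "(v_var * geometric_tail m * F) $ n $ d =
     (case d of 0 \<Rightarrow> 0 | Suc d' \<Rightarrow> \<Sum>i=1..n. (1 / real m ^ 2) ^ i * F $ (n - i) $ d')"
proof (cases d)
  case (Suc d')
  have "(v_var * geometric_tail m * F) $ n $ d = (geometric_tail m * F) $ n $ d'"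
    by (simp add: v_var_def mult.assoc Suc)
  also have "\<dots> = (\<Sum>i=0..n. (geometric_tail m $ i * F $ (n - i)) $ d')"
    by (simp add: fps_mult_nth fps_sum_nth)
  also have "\<dots> = (\<Sum>i=1..n. (1 / real m ^ 2) ^ i * F $ (n - i) $ d')"
    by (rule sum.mono_neutral_cong_right) (auto simp: geometric_tail_def)
  finally show ?thesis by (simp add: Suc)
qed (simp add: v_var_def mult.assoc)

lemma sign_mult_nth: "((-1) ^ k * F) $ n $ d = (-1) ^ k * F $ n $ d" for F :: "real fps fps"
  by (cases "even k") simp_all

lemma truncated_series_0: "truncated_series \<alpha> 0 = (if \<alpha> = 0 then 1 else 0)"
  by (auto simp: truncated_series_def truncated_A_at_0 fps_eq_iff)

lemma truncated_series_0_Suc: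
  "truncated_series 0 (Suc N) = truncated_series 0 N +
     v_var * geometric_tail (Suc N) * truncated_series 0 N"
  by (intro fps_ext)
     (simp add: v_var_mult_geometric_tail_mult_nth truncated_series_def truncated_A_Suc truncated_A_depth_0
       split: nat.split del: of_nat_Suc)

lemma truncated_series_1_Suc:
  "truncated_series 1 (Suc N) = truncated_series 1 N +
     v_var * geometric_tail (Suc N) * (truncated_series 1 N + (-1) ^ Suc N * truncated_series 0 N)"
  by (intro fps_ext)
     (simp add: v_var_mult_geometric_tail_mult_nth sign_mult_nth truncated_series_def truncated_A_Suc
       truncated_A_depth_0 split: nat.split del: of_nat_Suc power_Suc)

lemma truncated_diagonal_0: "truncated_diagonal 0 = 1"
  by (auto simp: truncated_diagonal_def truncated_A_at_0 fps_eq_iff)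

text \<open>Adding one entry raises the depth \<open>d\<close> and must raise \<open>\<alpha>\<close> too: no index has more signs \<open>-1\<close>
  than entries, so the term with sign \<open>+1\<close> is absent.\<close>

lemma truncated_diagonal_Suc:
  "truncated_diagonal (Suc N) = truncated_diagonal N +
     v_var * geometric_tail (Suc N) * ((-1) ^ Suc N * truncated_diagonal N)"
proof -
  have "truncated_A N (Suc d) n d = 0" for n d
    by (simp add: truncated_A_def A_index_empty)
  then show ?thesis
    by (intro fps_ext)
     (simp add: v_var_mult_geometric_tail_mult_nth sign_mult_nth truncated_diagonal_def truncated_A_Suc
       truncated_A_depth_0 split: nat.split del: of_nat_Suc power_Suc)
qed

lemma coeff_tendsto_truncated_series_1:
  "coeff_tendsto (truncated_series 1) (gen_series (\<lambda>n d. A 1 (2 * n) d))"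
  unfolding coeff_tendsto_def
proof (intro allI)
  fix n d
  have "A 1 (2 * n) d = 0" if "\<not> (1 \<le> d \<and> d \<le> n)"
  proof -
    have "A_index 1 (2 * n) d = {}" using that by (intro A_index_empty) linarith
    then show ?thesis by (simp add: A_def)
  qed
  then show "(\<lambda>N. truncated_series 1 N $ n $ d) \<longlonglongrightarrow> gen_series (\<lambda>n d. A 1 (2 * n) d) $ n $ d"
    using truncated_A_tendsto[of 1 n d] by (auto simp: truncated_series_def gen_series_def)
qed

lemma coeff_tendsto_truncated_diagonal:
  "coeff_tendsto truncated_diagonal (1 + gen_series (\<lambda>n d. A d (2 * n) d))"
  unfolding coeff_tendsto_def
proof (intro allI)
  fix n d
  have "A d (2 * n) d = (1 :: real fps fps) $ n $ d" if d: "\<not> (1 \<le> d \<and> d \<le> n)"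
  proof (cases "d = 0")
    case True
    then show ?thesis
      using LIMSEQ_unique[OF truncated_A_tendsto[of 0 n 0]]
      by (simp add: truncated_A_depth_0)
  next
    case False
    then have "A_index d (2 * n) d = {}" using d by (intro A_index_empty) linarith
    then show ?thesis using False by (simp add: A_def fps_one_nth)
  qed
  moreover have "(1 :: real fps fps) $ n $ d = 0" if "1 \<le> d"
    using that by (simp add: fps_one_nth)
  ultimately have "(1 + gen_series (\<lambda>n d. A d (2 * n) d)) $ n $ d = A d (2 * n) d"
    by (auto simp: gen_series_def)
  then show "(\<lambda>N. truncated_diagonal N $ n $ d) \<longlonglongrightarrow> (1 + gen_series (\<lambda>n d. A d (2 * n) d)) $ n $ d"
    using truncated_A_tendsto[of d n d] by (simp add: truncated_diagonal_def)
qed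

lemma sq_term_scale: "sq_term (w * c) n = fps_const w * sq_term c n"
  by (simp add: sq_term_def mult_ac flip: fps_const_mult)

lemma sq_term_quarter: "sq_term (w * fps_const (1 / 4)) n = sq_term w (2 * n)"
  by (simp add: sq_term_def power_mult_distrib mult.assoc)

lemma one_minus_v_var: "1 - v_var = fps_const (1 - fps_X)"
  by (simp add: v_var_def flip: fps_const_sub)

lemma one_plus_v_var: "1 + v_var = fps_const (1 + fps_X)"
  by (simp add: v_var_def flip: fps_const_add)

text \<open>Along \<open>2 N\<close> the even indices up to the bound are exactly \<open>2, 4, \<dots>, 2 N\<close>, as the splitting by
  parity requires. Multiplying by \<open>sinc w'\<close> beforehand avoids convergence of the logarithmic
  derivatives themselves.\<close>

lemma gen_series_1_sinc:
  fixes w :: "real fps"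
  defines "w \<equiv> 1 - fps_X"
  defines "w' \<equiv> w * fps_const (1 / 4)"
  shows "(1 - v_var) * (gen_series (\<lambda>n d. A 1 (2 * n) d) * sinc 1) * sinc w' =
    v_var * (sinc w' * (fps_X * fps_deriv (sinc w)) - 2 * (fps_X * fps_deriv (sinc w')) * sinc w)"
proof (rule coeff_tendsto_unique)
  have n: "sq_term w n = (1 - v_var) * sq_term 1 n" for n
    using sq_term_scale[of w 1 n] by (simp add: one_minus_v_var w_def)
  have "(1 - v_var) * (truncated_series 1 N * factor_prod (sq_term 1) N) = v_var * factor_alternating (sq_term w) N" for N
    by (rule one_sign_products[of geometric_tail "sq_term 1" "sq_term w" v_var "truncated_series 0" "truncated_series 1"])
       (simp_all only: geometric_tail_mult_one_minus n truncated_series_0 truncated_series_0_Suc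
         truncated_series_1_Suc if_True if_False one_neq_zero simp_thms)
  then have *: "(1 - v_var) * (truncated_series 1 (2 * N) * factor_prod (sq_term 1) (2 * N)) * factor_prod (sq_term w') N =
     v_var * (factor_prod (sq_term w') N * factor_alternating (sq_term w) (2 * N))" for N
    by (simp add: mult_ac)
  have **: "factor_prod (sq_term w') N * factor_alternating (sq_term w) (2 * N) =
     factor_prod (sq_term w') N * factor_euler (sq_term w) (2 * N) - 2 * factor_euler (sq_term w') N * factor_prod (sq_term w) (2 * N)" for N
    by (rule alternating_parity_split) (simp add: w'_def sq_term_quarter)
  show "coeff_tendsto (\<lambda>N. (1 - v_var) * (truncated_series 1 (2 * N) * factor_prod (sq_term 1) (2 * N)) * factor_prod (sq_term w') N)
      ((1 - v_var) * (gen_series (\<lambda>n d. A 1 (2 * n) d) * sinc 1) * sinc w')"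
    by (intro coeff_tendsto_mult coeff_tendsto_const coeff_tendsto_double
        coeff_tendsto_truncated_series_1 coeff_tendsto_factor_prod_sq_term)
  show "coeff_tendsto (\<lambda>N. (1 - v_var) * (truncated_series 1 (2 * N) * factor_prod (sq_term 1) (2 * N)) * factor_prod (sq_term w') N)
      (v_var * (sinc w' * (fps_X * fps_deriv (sinc w)) - 2 * (fps_X * fps_deriv (sinc w')) * sinc w))"
    unfolding * **
    by (intro coeff_tendsto_mult coeff_tendsto_diff coeff_tendsto_const
        coeff_tendsto_double[of "factor_euler _"] coeff_tendsto_double[of "factor_prod _"]
        coeff_tendsto_factor_euler_sq_term coeff_tendsto_factor_prod_sq_term)
qed

text \<open>The bound \<open>2 N\<close> makes the truncated product over even \<open>n\<close> a full truncation, at \<open>N\<close>, of the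
  product at a quarter of the argument.\<close>

lemma gen_series_diagonal_sinc:
  "(1 + gen_series (\<lambda>n d. A d (2 * n) d)) * sinc 1 * sinc ((1 + fps_X) * fps_const (1 / 4)) =
     sinc ((1 - fps_X) * fps_const (1 / 4)) * sinc (1 + fps_X)"
proof (rule coeff_tendsto_unique)
  let ?c = "sq_term ((1 + fps_X) * fps_const (1 / 4))" and ?d = "sq_term ((1 - fps_X) * fps_const (1 / 4))"
  have *: "truncated_diagonal (2 * N) * factor_prod (sq_term 1) (2 * N) * factor_prod ?c N =
      factor_prod ?d N * factor_prod (sq_term (1 + fps_X)) (2 * N)" for N
  proof (rule all_signs_products[of geometric_tail "sq_term 1" "sq_term (1 + fps_X)" v_var ?c ?d])
    show "sq_term (1 + fps_X) n = (1 + v_var) * sq_term 1 n" for n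
      using sq_term_scale[of "1 + fps_X" 1 n] by (simp add: one_plus_v_var)
    show "?d n = (1 - v_var) * sq_term 1 (2 * n)" for n
      using sq_term_scale[of "1 - fps_X" 1 "2 * n"] by (simp only: sq_term_quarter one_minus_v_var mult_1_right)
  qed (simp_all only: geometric_tail_mult_one_minus sq_term_quarter truncated_diagonal_0 truncated_diagonal_Suc)
  show "coeff_tendsto (\<lambda>N. truncated_diagonal (2 * N) * factor_prod (sq_term 1) (2 * N) * factor_prod ?c N)
      ((1 + gen_series (\<lambda>n d. A d (2 * n) d)) * sinc 1 * sinc ((1 + fps_X) * fps_const (1 / 4)))"
    by (intro coeff_tendsto_mult coeff_tendsto_double[of truncated_diagonal] coeff_tendsto_double[of "factor_prod _"]
        coeff_tendsto_truncated_diagonal coeff_tendsto_factor_prod_sq_term)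
  show "coeff_tendsto (\<lambda>N. truncated_diagonal (2 * N) * factor_prod (sq_term 1) (2 * N) * factor_prod ?c N)
      (sinc ((1 - fps_X) * fps_const (1 / 4)) * sinc (1 + fps_X))"
    unfolding *
    by (intro coeff_tendsto_mult coeff_tendsto_double[of "factor_prod _"] coeff_tendsto_factor_prod_sq_term)
qed

section \<open>Passage to closed formulas in the square root of u\<close>

lemma fps_to_fls_sum: "fps_to_fls (\<Sum>i\<in>I. f i) = (\<Sum>i\<in>I. fps_to_fls (f i))"
  by (induction I rule: infinite_finite_induct) simp_all

lemma embed_series_mult: "embed_series (F * G) = embed_series F * embed_series G"
proof -
  have "Abs_fps (\<lambda>n. fps_to_fls ((F * G) $ n)) =
      Abs_fps (\<lambda>n. fps_to_fls (F $ n)) * Abs_fps (\<lambda>n. fps_to_fls (G $ n))"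
    by (rule fps_ext) (simp add: fps_mult_nth fps_to_fls_sum fls_times_fps_to_fls)
  then show ?thesis
    unfolding embed_series_def by (simp add: fps_compose_mult_distrib)
qed

lemma embed_series_diff: "embed_series (F - G) = embed_series F - embed_series G"
  by (rule fps_ext) (simp add: embed_series_nth)

lemma embed_series_1: "embed_series 1 = 1"
  by (rule fps_ext) (auto simp: embed_series_nth)

lemma embed_series_0: "embed_series 0 = 0"
  using embed_series_diff[of 0 0] by simp

lemma embed_series_2: "embed_series 2 = 2"
proof -
  have "embed_series (1 - (0 - 1)) = 1 - (0 - 1)"
    unfolding embed_series_diff embed_series_1 embed_series_0 by (rule refl)
  then show ?thesis by simp
qed

lemma embed_series_v_var: "embed_series v_var = V"
  by (rule fps_ext) (auto simp: embed_series_nth v_var_def V_def)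

text \<open>The Euler operators satisfy \<open>2 u d/du = \<surd>u d/d\<surd>u\<close>.\<close>

lemma two_mult_embed_series_deriv:
  "2 * embed_series (fps_X * fps_deriv F) = fps_X * fps_deriv (embed_series F)"
proof (rule fps_ext)
  fix k
  have "(2 * embed_series (fps_X * fps_deriv F)) $ k = 2 * embed_series (fps_X * fps_deriv F) $ k"
    by (simp only: mult_2 fps_add_nth)
  also have "\<dots> = (fps_X * fps_deriv (embed_series F)) $ k"
  proof (cases "even k \<and> k > 0")
    case True
    then obtain m where "k = 2 * Suc m" by (metis dvdE gr0_conv_Suc nat_0_less_mult_iff)
    then show ?thesis
      by (simp add: embed_series_nth fls_times_fps_to_fls algebra_simps)
  next
    case False
    then show ?thesis by (auto simp: embed_series_nth)
  qed
  finally show "(2 * embed_series (fps_X * fps_deriv F)) $ k = (fps_X * fps_deriv (embed_series F)) $ k" .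
qed

text \<open>As \<open>sin z / z\<close> is even in \<open>z\<close>, the cofactor of \<open>b\<close> depends on \<open>b\<^sup>2\<close> only. This moves the square
  roots of \<open>1 - v\<close> and \<open>1 + v\<close> out of the series.\<close>

lemma fps_sin_eq_sinc:
  assumes "b ^ 2 = fls_const (pi ^ 2) * fps_to_fls w"
  shows "fps_sin b = fps_const b * fps_X * embed_series (sinc w)"
proof (rule fps_ext)
  fix k
  show "fps_sin b $ k = (fps_const b * fps_X * embed_series (sinc w)) $ k"
  proof (cases "odd k")
    case True
    then obtain i where k: "k = 2 * i + 1" by (elim oddE)
    have fact: "(fact n :: real fls) = fls_const (fact n)" for n
      by (metis fls_of_nat of_nat_fact)
    have "fps_sin b $ k = b * (b ^ 2) ^ i * ((-1) ^ i / fact k)"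
      by (simp add: fps_sin_def k mult_ac del: fact_Suc flip: power_mult)
    also have "(b ^ 2) ^ i = fls_const (pi ^ (2 * i)) * fps_to_fls (w ^ i)"
      by (simp add: assms power_mult_distrib fps_to_fls_power power_mult fls_const_power)
    also have "(-1) ^ i / fact k = fls_const ((-1) ^ i / fact k :: real)"
      unfolding fact fls_const_power fls_const_divide_const [symmetric] by simp
    also have "b * (fls_const (pi ^ (2 * i)) * fps_to_fls (w ^ i)) * fls_const ((-1) ^ i / fact k) =
        b * (fls_const ((-1) ^ i / fact k) * fls_const (pi ^ (2 * i)) * fps_to_fls (w ^ i))"
      by (simp only: mult_ac)
    also have "\<dots> = (fps_const b * fps_X * embed_series (sinc w)) $ k"
      by (simp add: k mult.assoc embed_series_nth sinc_def fls_times_fps_to_fls del: fact_Suc)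
    finally show ?thesis .
  next
    case False
    then show ?thesis
      by (cases k) (simp_all add: mult.assoc embed_series_nth fps_sin_def)
  qed
qed

text \<open>Differentiate \<open>fps_sin b\<close> in the form above with respect to \<open>\<surd>u\<close>.\<close>

lemma fps_cos_eq_sinc:
  assumes b: "b ^ 2 = fls_const (pi ^ 2) * fps_to_fls w" and "b \<noteq> 0"
  shows "fps_cos b = embed_series (sinc w) + 2 * embed_series (fps_X * fps_deriv (sinc w))"
proof -
  have "fps_const b * fps_cos b = fps_deriv (fps_const b * fps_X * embed_series (sinc w))"
    unfolding fps_sin_eq_sinc[OF b, symmetric] by (rule fps_sin_deriv [symmetric])
  also have "\<dots> = fps_const b * (embed_series (sinc w) + fps_X * fps_deriv (embed_series (sinc w)))"
    by (simp add: algebra_simps)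
  finally show ?thesis
    using \<open>b \<noteq> 0\<close> by (simp add: two_mult_embed_series_deriv)
qed

lemma fps_sin_double: "fps_sin b = 2 * fps_sin (b / 2) * fps_cos (b / 2)" for b :: "'a :: field_char_0"
  using fps_sin_add[of "b / 2" "b / 2"] by (simp add: mult_ac)

lemma fps_cos_double: "fps_cos b + 1 = 2 * fps_cos (b / 2) ^ 2" for b :: "'a :: field_char_0"
proof -
  let ?c = "fps_cos (b / 2)" and ?s = "fps_sin (b / 2)"
  have "fps_cos b = ?c * ?c - ?s * ?s"
    using fps_cos_add[of "b / 2" "b / 2"] by simp
  moreover have "?c * ?c + ?s * ?s = 1"
    using fps_sin_cos_sum_of_squares[of "b / 2"] by (simp add: power2_eq_square)
  ultimately have "fps_cos b + 1 = (?c * ?c - ?s * ?s) + (?c * ?c + ?s * ?s)"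
    by simp
  then show ?thesis by (simp add: power2_eq_square)
qed

lemma fps_sin_neq_0: "b \<noteq> 0 \<Longrightarrow> fps_sin b \<noteq> 0" for b :: "'a :: field_char_0"
  using subdegree_fps_sin by force

lemma half_square:
  fixes b :: "real fls"
  assumes "b ^ 2 = fls_const (pi ^ 2) * fps_to_fls w"
  shows "(b / 2) ^ 2 = fls_const (pi ^ 2) * fps_to_fls (w * fps_const (1 / 4))"
proof -
  have "fls_const (1 / 4) = 1 / (4 :: real fls)"
    unfolding fls_const_divide_const [symmetric] by simp
  then show ?thesis
    by (simp add: power_divide assms fls_times_fps_to_fls)
qed

text \<open>Let \<open>e, e'\<close> be the images of \<^const>\<open>sinc\<close> at \<open>w = 1 - v\<close> and at \<open>w/4\<close>, and \<open>D, D'\<close> those of their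
  Euler derivatives. Then \<open>c = e + 2 D\<close> and \<open>c' = e' + 2 D'\<close> are the cosines of an angle and of its
  half, and the duplication formulas \<open>e = e' c'\<close> and \<open>c + 1 = 2 c'\<^sup>2\<close> collapse \<open>2 (e' D - 2 D' e)\<close> to
  \<open>e' (e - 1)\<close>. The factor \<open>e'\<close> cancels.\<close>

lemma embed_gen_series_1:
  assumes b: "b ^ 2 = fls_const (pi ^ 2) * fps_to_fls (1 - fps_X)" and "b \<noteq> 0"
  shows "2 * (1 - V) * embed_series (gen_series (\<lambda>n d. A 1 (2 * n) d)) * embed_series (sinc 1) =
    V * (embed_series (sinc (1 - fps_X)) - 1)"
proof -
  define w :: "real fps" where "w = 1 - fps_X"
  define w' where "w' = w * fps_const (1 / 4)"
  define G where "G = embed_series (gen_series (\<lambda>n d. A 1 (2 * n) d))"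
  define e where "e = embed_series (sinc w)"
  define e' where "e' = embed_series (sinc w')"
  define D where "D = embed_series (fps_X * fps_deriv (sinc w))"
  define D' where "D' = embed_series (fps_X * fps_deriv (sinc w'))"
  note b' = half_square[OF b, folded w_def, folded w'_def]
  have b2: "b / 2 \<noteq> 0" using \<open>b \<noteq> 0\<close> by simp
  have s: "fps_sin b = fps_const b * fps_X * e" and c: "fps_cos b = e + 2 * D"
    unfolding e_def D_def using fps_sin_eq_sinc fps_cos_eq_sinc b \<open>b \<noteq> 0\<close> by (auto simp: w_def)
  have s': "fps_sin (b / 2) = fps_const (b / 2) * fps_X * e'" and c': "fps_cos (b / 2) = e' + 2 * D'"
    unfolding e'_def D'_def using fps_sin_eq_sinc[OF b'] fps_cos_eq_sinc[OF b' b2] by auto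
  have two: "2 * fps_const (b / 2) = fps_const b"
    by (simp add: numeral_fps_const)
  have "e' \<noteq> 0" using fps_sin_neq_0[OF b2] unfolding s' by auto
  have "fps_const b * fps_X * e = (2 * fps_const (b / 2)) * fps_X * (e' * fps_cos (b / 2))"
    using fps_sin_double[of b] unfolding s s' by (simp add: mult_ac)
  then have e: "e = e' * (e' + 2 * D')"
    using \<open>b \<noteq> 0\<close> unfolding two c' by simp
  have d: "e + 2 * D + 1 = 2 * (e' + 2 * D') ^ 2"
    using fps_cos_double[of b] unfolding c c' .
  have main: "(1 - V) * (G * embed_series (sinc 1)) * e' = V * (e' * D - 2 * D' * e)"
    using arg_cong[OF gen_series_1_sinc, of embed_series]
    unfolding embed_series_mult[of _ "_ :: real fps fps"] embed_series_diff embed_series_1 embed_series_2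
      embed_series_v_var
    by (simp only: G_def e'_def D_def D'_def e_def w'_def w_def embed_series_mult)
  have "2 * (e' * D - 2 * D' * e) = e' * (e - 1)"
  proof -
    have "2 * (e' * D - 2 * D' * e) = e' * (e + 2 * D + 1) - 2 * (e' + 2 * D') * e + e' * (e - 1)"
      by (simp add: algebra_simps)
    also have "e' * (e + 2 * D + 1) = 2 * (e' + 2 * D') * e"
      unfolding d by (subst e) (simp add: power2_eq_square mult_ac)
    finally show ?thesis by simp
  qed
  then have "(2 * (1 - V) * G * embed_series (sinc 1)) * e' = (V * (e - 1)) * e'"
    using arg_cong[OF main, of "\<lambda>t. 2 * t"] by (simp add: mult_ac)
  then show ?thesis
    using \<open>e' \<noteq> 0\<close> unfolding G_def e_def w_def by simp
qed

text \<open>After duplication of \<open>fps_sin p\<close> and \<open>fps_sin (p * t)\<close>, both sides share the factor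
  \<open>2 * fps_sin (p * t / 2)\<close>.\<close>

lemma embed_gen_series_diagonal:
  fixes r t :: "real fls"
  assumes r: "r ^ 2 = fps_to_fls (1 - fps_X)" "r \<noteq> 0" and t: "t ^ 2 = fps_to_fls (1 + fps_X)" "t \<noteq> 0"
  defines "p \<equiv> fls_const pi"
  shows "embed_series (1 + gen_series (\<lambda>n d. A d (2 * n) d)) *
      (fps_const r * fps_sin (p / 2)) * fps_cos (p / 2) =
    fps_sin (p * r / 2) * fps_cos (p * t / 2)"
proof -
  define P where "P = embed_series (1 + gen_series (\<lambda>n d. A d (2 * n) d))"
  have p2: "p ^ 2 = fls_const (pi ^ 2) * fps_to_fls 1"
    by (simp add: p_def fls_const_power)
  have pr2: "(p * r) ^ 2 = fls_const (pi ^ 2) * fps_to_fls (1 - fps_X)"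
    and pt2: "(p * t) ^ 2 = fls_const (pi ^ 2) * fps_to_fls (1 + fps_X)"
    using p2 r t by (simp_all add: power_mult_distrib)
  note s1 = fps_sin_eq_sinc[OF p2] and s2 = fps_sin_eq_sinc[OF half_square[OF pr2]]
    and s3 = fps_sin_eq_sinc[OF half_square[OF pt2]] and s4 = fps_sin_eq_sinc[OF pt2]
  have main: "P * embed_series (sinc 1) * embed_series (sinc ((1 + fps_X) * fps_const (1 / 4))) =
      embed_series (sinc ((1 - fps_X) * fps_const (1 / 4))) * embed_series (sinc (1 + fps_X))"
    unfolding P_def embed_series_mult [symmetric] gen_series_diagonal_sinc ..
  have pt0: "p * t / 2 \<noteq> 0" using t by (simp add: p_def fls_const_nonzero)
  have h: "fps_const (p * r / 2) * fps_const (p * t) = fps_const r * fps_const p * fps_const (p * t / 2)"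
    by (simp add: mult_ac)
  have "(P * (fps_const r * fps_sin p)) * fps_sin (p * t / 2) =
      (fps_const r * fps_const p * fps_const (p * t / 2)) * fps_X * fps_X *
      (P * embed_series (sinc 1) * embed_series (sinc ((1 + fps_X) * fps_const (1 / 4))))"
    unfolding s1 s3 by (simp only: mult_ac)
  also have "\<dots> = fps_sin (p * r / 2) * fps_sin (p * t)"
    unfolding main s2 s4 h [symmetric] by (simp only: mult_ac)
  finally have "(2 * fps_sin (p * t / 2)) * (P * (fps_const r * fps_sin (p / 2)) * fps_cos (p / 2)) =
      (2 * fps_sin (p * t / 2)) * (fps_sin (p * r / 2) * fps_cos (p * t / 2))"
    using fps_sin_double[of p] fps_sin_double[of "p * t"] by (simp add: mult_ac)
  moreover have "2 * fps_sin (p * t / 2) \<noteq> 0"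
    using fps_sin_neq_0[OF pt0] by simp
  ultimately show ?thesis unfolding P_def using mult_left_cancel by blast
qed

lemma fps_divide_2: "F / 2 = F * fps_const (1 / 2)" for F :: "real fls fps"
proof -
  have "F * fps_const (1 / 2) * 2 = F * fps_const (1 / 2 * 2)"
    by (simp only: numeral_fps_const fps_const_mult mult.assoc)
  then have "F * fps_const (1 / 2) * 2 = F" by simp
  then show ?thesis
    by (metis nonzero_mult_div_cancel_right zero_neq_numeral)
qed

theorem theorem1p5:
  shows "(embed_series (gen_series (\<lambda>n d. A 1 (2 * n) d)) =
      V * Sin (PI * sqrt_1_minus_v * sqrt_u) / (sqrt_1_minus_v * Sin (PI * sqrt_u)) *
        (1 / (2 * (1 - V)) -
         PI * sqrt_u / (2 * sqrt_1_minus_v * Sin (PI * sqrt_1_minus_v * sqrt_u))))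
    \<and> (embed_series (1 + gen_series (\<lambda>n d. A d (2 * n) d)) =
      Sin (PI * sqrt_1_minus_v * sqrt_u / 2) / (sqrt_1_minus_v * Sin (PI * sqrt_u / 2)) *
        (Cos (PI * sqrt_1_plus_v * sqrt_u / 2) / Cos (PI * sqrt_u / 2)))"
proof -
  define r where "r = fps_to_fls (fps_radical root 2 (1 - fps_X :: real fps))"
  define t where "t = fps_to_fls (fps_radical root 2 (1 + fps_X :: real fps))"
  define p :: "real fls" where "p = fls_const pi"
  have R: "sqrt_1_minus_v = fps_const r" and T: "sqrt_1_plus_v = fps_const t"
    by (simp_all add: sqrt_1_minus_v_def sqrt_1_plus_v_def r_def t_def)
  have "fps_const (r ^ 2) = fps_const (fps_to_fls (1 - fps_X))"
    using sqrt_1_minus_v_square by (simp add: R V_def flip: fps_const_sub)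
  then have r2: "r ^ 2 = fps_to_fls (1 - fps_X)"
    by (drule_tac arg_cong[where f = "\<lambda>F. F $ 0"]) simp
  have "fps_const (t ^ 2) = fps_const (fps_to_fls (1 + fps_X))"
    using sqrt_1_plus_v_square by (simp add: T V_def flip: fps_const_add)
  then have t2: "t ^ 2 = fps_to_fls (1 + fps_X)"
    by (drule_tac arg_cong[where f = "\<lambda>F. F $ 0"]) simp
  have "(1 - fps_X :: real fps) $ 0 \<noteq> 0" "(1 + fps_X :: real fps) $ 0 \<noteq> 0" by simp_all
  then have "(1 - fps_X :: real fps) \<noteq> 0" "(1 + fps_X :: real fps) \<noteq> 0"
    using fps_zero_nth[of 0] by force+
  then have "r ^ 2 \<noteq> 0" "t ^ 2 \<noteq> 0"
    unfolding r2 t2 fps_to_fls_eq_0_iff .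
  then have r0: "r \<noteq> 0" and t0: "t \<noteq> 0" by auto
  have p0: "p \<noteq> 0" by (simp add: p_def fls_const_nonzero)
  have p2: "p ^ 2 = fls_const (pi ^ 2) * fps_to_fls 1"
    by (simp add: p_def fls_const_power)
  have pr2: "(p * r) ^ 2 = fls_const (pi ^ 2) * fps_to_fls (1 - fps_X)"
    using p2 r2 by (simp add: power_mult_distrib)
  have pu: "PI * sqrt_u = fps_const p * fps_X"
    by (simp add: PI_def sqrt_u_def p_def)
  have s1: "Sin (PI * sqrt_u) = fps_sin p"
    unfolding pu by (rule Sin_const_mult_X)
  have "PI * sqrt_1_minus_v * sqrt_u = fps_const (p * r) * fps_X"
    by (simp add: PI_def sqrt_u_def p_def R)
  then have s2: "Sin (PI * sqrt_1_minus_v * sqrt_u) = fps_sin (p * r)"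
    by (simp only: Sin_const_mult_X)
  have half: "fps_const c * fps_X / 2 = fps_const (c / 2) * fps_X" for c :: "real fls"
    unfolding fps_divide_2 by (simp add: mult_ac)
  have s3: "Sin (PI * sqrt_u / 2) = fps_sin (p / 2)" "Cos (PI * sqrt_u / 2) = fps_cos (p / 2)"
    unfolding pu half by (rule Sin_const_mult_X Cos_const_mult_X)+
  have s4: "Sin (PI * sqrt_1_minus_v * sqrt_u / 2) = fps_sin (p * r / 2)"
    unfolding \<open>PI * sqrt_1_minus_v * sqrt_u = _\<close> half by (rule Sin_const_mult_X)
  have "PI * sqrt_1_plus_v * sqrt_u = fps_const (p * t) * fps_X"
    by (simp add: PI_def sqrt_u_def p_def T)
  then have s5: "Cos (PI * sqrt_1_plus_v * sqrt_u / 2) = fps_cos (p * t / 2)"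
    by (simp only: half Cos_const_mult_X)

  have "embed_series (gen_series (\<lambda>n d. A 1 (2 * n) d)) =
      V * Sin (PI * sqrt_1_minus_v * sqrt_u) / (sqrt_1_minus_v * Sin (PI * sqrt_u)) *
        (1 / (2 * (1 - V)) -
         PI * sqrt_u / (2 * sqrt_1_minus_v * Sin (PI * sqrt_1_minus_v * sqrt_u)))"
    (is "?G = ?q1 * (?q2 - ?q3)")
  proof -
    let ?r = "fps_const r" and ?e = "embed_series (sinc (1 - fps_X))" and ?e1 = "embed_series (sinc 1)"
    define q1 q2 q3 where "q1 = ?q1" and "q2 = ?q2" and "q3 = ?q3"
    have V: "1 - V = ?r * ?r"
      using sqrt_1_minus_v_square by (simp only: R power2_eq_square)
    have q1: "q1 * (?r * fps_sin p) = V * fps_sin (p * r)"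
      using dvd_div_mult_self[OF exact_quotients(1)] unfolding q1_def s1 s2 unfolding R .
    have q2: "q2 * (2 * (?r * ?r)) = 1"
      using dvd_div_mult_self[OF exact_quotients(2)] unfolding q2_def V .
    have q3: "q3 * (2 * ?r * fps_sin (p * r)) = fps_const p * fps_X"
      using dvd_div_mult_self[OF exact_quotients(3)] unfolding q3_def s2 unfolding R pu .
    have G: "2 * (?r * ?r) * ?G * ?e1 = V * (?e - 1)"
      unfolding V [symmetric] by (rule embed_gen_series_1[OF pr2]) (use r0 p0 in simp)
    have s: "fps_sin p = fps_const p * fps_X * ?e1"
      by (rule fps_sin_eq_sinc[OF p2])
    have s': "fps_sin (p * r) = ?r * fps_const p * fps_X * ?e"
      using fps_sin_eq_sinc[OF pr2] by (simp add: mult_ac)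
    \<comment> \<open>After clearing denominators each quotient occurs next to its own denominator.\<close>
    have "(2 * (?r * ?r) * (?r * fps_sin p)) * (q1 * (q2 - q3)) =
        (q1 * (?r * fps_sin p)) * (q2 * (2 * (?r * ?r)) - 2 * (?r * ?r) * q3)"
      by (simp only: right_diff_distrib left_diff_distrib mult_ac)
    also have "\<dots> = V * (fps_sin (p * r) * (1 - 2 * (?r * ?r) * q3))"
      unfolding q1 q2 by (simp only: mult_ac)
    also have "\<dots> = V * (fps_sin (p * r) - ?r * (q3 * (2 * ?r * fps_sin (p * r))))"
      by (simp only: right_diff_distrib mult_1_left mult_1_right mult_ac)
    also have "\<dots> = (?r * fps_const p * fps_X) * (V * (?e - 1))"
      unfolding q3 unfolding s' by (simp only: right_diff_distrib mult_1_left mult_1_right mult_ac)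
    also have "\<dots> = (2 * (?r * ?r) * (?r * fps_sin p)) * ?G"
      unfolding G [symmetric] s by (simp only: mult_ac)
    finally have "(2 * (?r * ?r) * (?r * fps_sin p)) * ?G =
        (2 * (?r * ?r) * (?r * fps_sin p)) * (q1 * (q2 - q3))" ..
    moreover have "2 * (?r * ?r) * (?r * fps_sin p) \<noteq> 0"
      using r0 fps_sin_neq_0[OF p0] by simp
    ultimately have "?G = q1 * (q2 - q3)" using mult_left_cancel by blast
    then show ?thesis unfolding q1_def q2_def q3_def .
  qed
  moreover have "embed_series (1 + gen_series (\<lambda>n d. A d (2 * n) d)) =
      Sin (PI * sqrt_1_minus_v * sqrt_u / 2) / (sqrt_1_minus_v * Sin (PI * sqrt_u / 2)) *
        (Cos (PI * sqrt_1_plus_v * sqrt_u / 2) / Cos (PI * sqrt_u / 2))"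
    (is "?P = ?q1 * ?q2")
  proof -
    let ?n = "fps_const r * fps_sin (p / 2)" and ?c = "fps_cos (p / 2)"
    have q1: "?q1 * ?n = fps_sin (p * r / 2)"
      using dvd_div_mult_self[OF exact_quotients(4)] unfolding s3 s4 unfolding R .
    have q2: "?q2 * ?c = fps_cos (p * t / 2)"
      using dvd_div_mult_self[OF exact_quotients(5)] unfolding s3 s5 .
    have "?P * ?n * ?c = (?q1 * ?n) * (?q2 * ?c)"
      unfolding q1 q2 unfolding p_def by (rule embed_gen_series_diagonal[OF r2 r0 t2 t0])
    then have "(?n * ?c) * ?P = (?n * ?c) * (?q1 * ?q2)"
      by (simp only: mult.assoc mult.commute mult.left_commute)
    moreover have "?n * ?c \<noteq> 0"
    proof -
      have "?c $ 0 \<noteq> 0" by simp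
      then have "?c \<noteq> 0" by force
      then show ?thesis using r0 p0 fps_sin_neq_0[of "p / 2"] by simp
    qed
    ultimately show ?thesis using mult_left_cancel by blast
  qed
  ultimately show ?thesis by blast
qed

end
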